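(* Let $\Phi : \mathscr{S} \ni s \mapsto T_s \in \mathscr{L}(X)$ be a homomorphism of a strongly [resp. weakly] right amenable SGT $\mathscr{S}$ into $\mathscr{L}(X)$, where $X$ is a Banach space. Suppose $Y$ is a closed linear subspace of $X$ such that: (p0) $\Phi$ is continuous in the strong operator topology [resp. operator norm topology] of $\mathscr{L}(X)$; (p1) for any $s \in \mathscr{S}$, $T_s(Y) = Y$ and the restriction $T_s|_Y$ of $T_s$ to $Y$ is an isomorphism; (p2) $Y$ is a dual Banach space, that is, $Y$ is linearly isometric to the dual space of some Banach space (and thus the closed unit ball $B_Y$ of $Y$ is compact with respect to a certain locally convex topology of $Y$, called weak* ); (p3) for any $s \in \mathscr{S}$, $T_s|_Y$ is weak* continuous on $B_Y$; (p4') the quantity $m_Y(\Phi) = \sup_{s\in\mathscr{S}} (\|T_s\| \cdot \|(T_s|_Y)^{-1}\|)$ is finite. Then there exists a $\Phi$-minimal projection $P_0 : X \to Y$ if and only if $Y$ is a complemented subspace of $X$. Moreover, if $Y$ is complemented, each $\Phi$-minimal projection $P : X \to Y$ satisfies $\|P\| \leqslant m_Y(\Phi)\, \lambda(X,Y)$. (The statement consists of two versions: "strongly / strong operator topology" and "weakly / operator norm topology".)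
   Context: An SGT (semigroup with topology) is a non-empty semigroup $\mathscr{S}$ that is also a (possibly non-Hausdorff) topological space; no compatibility between the multiplication and the topology is assumed. For $f:\mathscr{S}\to\mathbb{R}$ and $s\in\mathscr{S}$ let $f_s(t)=f(ts)$. $C_b(\mathscr{S})$ is the space of bounded continuous real-valued functions on $\mathscr{S}$ with the sup-norm, and $C_r(\mathscr{S})=\{f\in C_b(\mathscr{S}): f_s \text{ is continuous for every } s\in\mathscr{S}\}$. Let $C_{norm}(\mathscr{S})$ [resp. $C_{weak}(\mathscr{S})$] be the set of all $f\in C_r(\mathscr{S})$ such that $s\mapsto f_s$ and, for all $t\in\mathscr{S}$, $s\mapsto f_{st}$ are continuous from $\mathscr{S}$ to $C_r(\mathscr{S})$ equipped with its norm [resp. weak] topology. A mean on a linear subspace $\mathscr{F}$ of $C_r(\mathscr{S})$ is a linear functional $\phi:\mathscr{F}\to\mathbb{R}$ with $\inf f(\mathscr{S})\leqslant\phi(f)\leqslant\sup f(\mathscr{S})$ for all $f\in\mathscr{F}$; if $\mathscr{F}$ is right invariant ($f_s\in\mathscr{F}$ for $f\in\mathscr{F}$, $s\in\mathscr{S}$), the mean is right invariant if $\phi(f_s)=\phi(f)$ for all $f\in\mathscr{F}$, $s\in\mathscr{S}$. $\mathscr{S}$ is weakly [resp. strongly] right amenable if there is a right invariant mean on $C_{norm}(\mathscr{S})$ [resp. $C_{weak}(\mathscr{S})$]. Banach spaces are real or complex. $\mathscr{L}(X)$ is the algebra of bounded linear operators on $X$; $s\mapsto T_s$ is a homomorphism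 if $T_{st}=T_sT_t$ for all $s,t$. A projection $P:X\to Y$ is a bounded linear operator with $Py=y$ for all $y\in Y$; $Y$ is complemented if such a projection exists, and then $\lambda(X,Y)=\inf\{\|P\|: P:X\to Y \text{ a projection}\}$. "Isomorphism" means a linear bijection of $Y$ onto $Y$ bounded with bounded inverse. A projection $P_0:X\to Y$ is $\Phi$-minimal if $P_0$ commutes with all $T_s$ and $\|P_0\|\leqslant\|P\|$ for any other projection $P:X\to Y$ that commutes with all $T_s$. *)

theory Defs
  imports "HOL-Analysis.Analysis"
begin

section \<open>Linear maps and topologies on subspaces\<close>

text \<open>
  Maps defined on a subspace \<open>V\<close> are modelled by total functions; only their values on \<open>V\<close>
  matter.
\<close>

definition linear_on ::
  "('k \<Rightarrow> 'a \<Rightarrow> 'a) \<Rightarrow> ('k \<Rightarrow> 'b \<Rightarrow> 'b) \<Rightarrow> 'a::ab_group_add set \<Rightarrow> ('a \<Rightarrow> 'b::ab_group_add) \<Rightarrow> bool" where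
  "linear_on s1 s2 V f \<longleftrightarrow>
     (\<forall>x\<in>V. \<forall>y\<in>V. f (x + y) = f x + f y) \<and> (\<forall>c. \<forall>x\<in>V. f (s1 c x) = s2 c (f x))"

definition bounded_on :: "'a::real_normed_vector set \<Rightarrow> ('a \<Rightarrow> 'b::real_normed_vector) \<Rightarrow> bool" where
  "bounded_on V f \<longleftrightarrow> (\<exists>C. \<forall>x\<in>V. norm (f x) \<le> C * norm x)"

text \<open>The operator norm of a bounded linear map on \<open>V\<close>.\<close>

definition onorm_on :: "'a::real_normed_vector set \<Rightarrow> ('a \<Rightarrow> 'b::real_normed_vector) \<Rightarrow> real" where
  "onorm_on V f = (SUP x\<in>{x\<in>V. norm x \<le> 1}. norm (f x))"

text \<open>The coarsest topology on the set \<open>A\<close> making all functions in \<open>F\<close> (nonempty) continuous.\<close>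

definition initial_topology :: "'a set \<Rightarrow> ('a \<Rightarrow> 'b::topological_space) set \<Rightarrow> 'a topology" where
  "initial_topology A F = topology_generated_by {{x\<in>A. f x \<in> U} | f U. f \<in> F \<and> open U}"

text \<open>The weak topology of a real normed space, given as a linear subspace of a normed space.\<close>

definition weak_topology :: "'a::real_normed_vector set \<Rightarrow> 'a topology" where
  "weak_topology V =
     initial_topology V {\<psi> :: 'a \<Rightarrow> real. linear_on scaleR scaleR V \<psi> \<and> bounded_on V \<psi>}"


section \<open>Semigroups with topology and amenability\<close>

text \<open>
  A semigroup with topology is a type of sort \<open>{semigroup_mult, topological_space}\<close>; these classes
  impose no separation axiom and no continuity of the multiplication.
\<close>

definition right_translate ::
  "'s \<Rightarrow> ('s::{semigroup_mult,topological_space} \<Rightarrow>\<^sub>C real) \<Rightarrow> ('s \<Rightarrow>\<^sub>C real)" where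
  "right_translate s f = Bcontfun (\<lambda>t. apply_bcontfun f (t * s))"

text \<open>
  \<open>right_translate s f\<close> is only meaningful if \<open>\<lambda>t. f (t * s)\<close> is continuous, as is
  guaranteed on the following space.
\<close>

definition C_r :: "('s::{semigroup_mult,topological_space} \<Rightarrow>\<^sub>C real) set" where
  "C_r = {f. \<forall>s. continuous_on UNIV (\<lambda>t. apply_bcontfun f (t * s))}"

lemma apply_right_translate:
  assumes "f \<in> C_r"
  shows "apply_bcontfun (right_translate s f) t = apply_bcontfun f (t * s)"
proof -
  have "(\<lambda>t. apply_bcontfun f (t * s)) \<in> bcontfun"
    using assms norm_bounded[of f] by (intro bcontfun_normI[where b = "norm f"]) (auto simp: C_r_def)
  then show ?thesis
    by (simp add: right_translate_def Bcontfun_inverse)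
qed

definition right_invariant :: "('s::{semigroup_mult,topological_space} \<Rightarrow>\<^sub>C real) set \<Rightarrow> bool" where
  "right_invariant F \<longleftrightarrow> (\<forall>f\<in>F. \<forall>s. right_translate s f \<in> F)"

definition C_norm :: "('s::{semigroup_mult,topological_space} \<Rightarrow>\<^sub>C real) set" where
  "C_norm = {f \<in> C_r.
     continuous_map euclidean (top_of_set C_r) (\<lambda>s. right_translate s f) \<and>
     (\<forall>t. continuous_map euclidean (top_of_set C_r) (\<lambda>s. right_translate (s * t) f))}"

definition C_weak :: "('s::{semigroup_mult,topological_space} \<Rightarrow>\<^sub>C real) set" where
  "C_weak = {f \<in> C_r.
     continuous_map euclidean (weak_topology C_r) (\<lambda>s. right_translate s f) \<and>
     (\<forall>t. continuous_map euclidean (weak_topology C_r) (\<lambda>s. right_translate (s * t) f))}"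

lemma right_translate_C_r:
  assumes "f \<in> C_r"
  shows "right_translate s f \<in> C_r"
    and "right_translate t (right_translate s f) = right_translate (t * s) f"
proof -
  show *: "right_translate s f \<in> C_r"
    using assms by (simp add: C_r_def apply_right_translate[OF assms] mult.assoc)
  show "right_translate t (right_translate s f) = right_translate (t * s) f"
    by (rule bcontfun_eqI) (simp add: apply_right_translate[OF assms] apply_right_translate[OF *] mult.assoc)
qed

lemma right_invariant_C_norm: "right_invariant C_norm"
  by (auto simp: right_invariant_def C_norm_def right_translate_C_r mult.assoc)

lemma right_invariant_C_weak: "right_invariant C_weak"
  by (auto simp: right_invariant_def C_weak_def right_translate_C_r mult.assoc)

definition is_mean ::
  "('s::{semigroup_mult,topological_space} \<Rightarrow>\<^sub>C real) set \<Rightarrow> (('s \<Rightarrow>\<^sub>C real) \<Rightarrow> real) \<Rightarrow> bool" where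
  "is_mean F \<phi> \<longleftrightarrow> linear_on scaleR scaleR F \<phi> \<and>
     (\<forall>f\<in>F. (INF t. apply_bcontfun f t) \<le> \<phi> f \<and> \<phi> f \<le> (SUP t. apply_bcontfun f t))"

definition right_invariant_mean ::
  "('s::{semigroup_mult,topological_space} \<Rightarrow>\<^sub>C real) set \<Rightarrow> (('s \<Rightarrow>\<^sub>C real) \<Rightarrow> real) \<Rightarrow> bool" where
  "right_invariant_mean F \<phi> \<longleftrightarrow>
     is_mean F \<phi> \<and> (\<forall>f\<in>F. \<forall>s. \<phi> (right_translate s f) = \<phi> f)"

definition weakly_right_amenable :: "'s::{semigroup_mult,topological_space} itself \<Rightarrow> bool" where
  "weakly_right_amenable _ \<longleftrightarrow> (\<exists>\<phi>. right_invariant_mean (C_norm :: ('s \<Rightarrow>\<^sub>C real) set) \<phi>)"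

definition strongly_right_amenable :: "'s::{semigroup_mult,topological_space} itself \<Rightarrow> bool" where
  "strongly_right_amenable _ \<longleftrightarrow> (\<exists>\<phi>. right_invariant_mean (C_weak :: ('s \<Rightarrow>\<^sub>C real) set) \<phi>)"


section \<open>Real and complex Banach spaces\<close>

text \<open>
  The sort \<open>{real_normed_field, euclidean_space}\<close> captures exactly the scalar fields of real and
  complex numbers: by Frobenius' theorem these are the only finite-dimensional commutative
  division algebras over the reals, and their multiplicative norm is unique. A Banach space over
  \<open>'k\<close> is a real Banach space with a compatible action of \<open>'k\<close>; for \<open>'k = real\<close>
  that action is necessarily \<open>scaleR\<close>. Since \<open>'k\<close> contains the reals, operator norms and
  (norm or strong) operator topologies of \<open>'k\<close>-linear operators are those of the underlying
  real-linear operators.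
\<close>

locale banach_space_over = vector_space sc
  for sc :: "'k::{real_normed_field,euclidean_space} \<Rightarrow> 'x::banach \<Rightarrow> 'x" +
  assumes scale_of_real: "sc (of_real r) x = r *\<^sub>R x"
    and norm_scale: "norm (sc a x) = norm a * norm x"

lemma banach_space_over_real: "banach_space_over (scaleR :: real \<Rightarrow> 'x::banach \<Rightarrow> 'x)"
  by unfold_locales (auto simp: algebra_simps)

lemma banach_space_over_complex: "banach_space_over ((*) :: complex \<Rightarrow> complex \<Rightarrow> complex)"
  by unfold_locales (auto simp: algebra_simps norm_mult scaleR_conv_of_real)

definition operators :: "('k \<Rightarrow> 'x \<Rightarrow> 'x) \<Rightarrow> ('x::real_normed_vector \<Rightarrow>\<^sub>L 'x) set" where
  "operators sc = {A. linear_on sc sc UNIV (blinfun_apply A)}"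

definition dual_space ::
  "('k \<Rightarrow> 'z \<Rightarrow> 'z) \<Rightarrow> ('z::real_normed_vector \<Rightarrow>\<^sub>L 'k::real_normed_field) set" where
  "dual_space sc = {g. linear_on sc (*) UNIV (blinfun_apply g)}"

text \<open>\<open>J\<close> is a linear isometry of \<open>Y\<close> onto the dual of \<open>Z\<close> (the type \<open>'z\<close>).\<close>

definition dual_isometry ::
  "('k \<Rightarrow> 'x \<Rightarrow> 'x) \<Rightarrow> 'x set \<Rightarrow> ('k \<Rightarrow> 'z \<Rightarrow> 'z) \<Rightarrow>
   ('x::real_normed_vector \<Rightarrow> ('z::real_normed_vector \<Rightarrow>\<^sub>L 'k::real_normed_field)) \<Rightarrow> bool" where
  "dual_isometry scaleX Y scaleZ J \<longleftrightarrow>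
     bij_betw J Y (dual_space scaleZ) \<and>
     (\<forall>z. linear_on scaleX (*) Y (\<lambda>y. blinfun_apply (J y) z)) \<and>
     (\<forall>y\<in>Y. norm (J y) = norm y)"

definition weak_star_topology ::
  "'x set \<Rightarrow> ('x \<Rightarrow> ('z::real_normed_vector \<Rightarrow>\<^sub>L 'k::real_normed_vector)) \<Rightarrow> 'x topology" where
  "weak_star_topology Y J = initial_topology Y (range (\<lambda>z y. blinfun_apply (J y) z))"

definition isomorphism_on ::
  "('k \<Rightarrow> 'x \<Rightarrow> 'x) \<Rightarrow> 'x::real_normed_vector set \<Rightarrow> ('x \<Rightarrow> 'x) \<Rightarrow> bool" where
  "isomorphism_on sc Y A \<longleftrightarrow>
     linear_on sc sc Y A \<and> bij_betw A Y Y \<and> bounded_on Y A \<and> bounded_on Y (inv_into Y A)"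


section \<open>Projections\<close>

definition is_projection ::
  "('k \<Rightarrow> 'x \<Rightarrow> 'x) \<Rightarrow> 'x::real_normed_vector set \<Rightarrow> ('x \<Rightarrow>\<^sub>L 'x) \<Rightarrow> bool" where
  "is_projection sc Y P \<longleftrightarrow>
     P \<in> operators sc \<and> range (blinfun_apply P) \<subseteq> Y \<and> (\<forall>y\<in>Y. blinfun_apply P y = y)"

definition complemented :: "('k \<Rightarrow> 'x \<Rightarrow> 'x) \<Rightarrow> 'x::real_normed_vector set \<Rightarrow> bool" where
  "complemented sc Y \<longleftrightarrow> (\<exists>P. is_projection sc Y P)"

definition proj_const :: "('k \<Rightarrow> 'x \<Rightarrow> 'x) \<Rightarrow> 'x::real_normed_vector set \<Rightarrow> real" where
  "proj_const sc Y = (INF P\<in>{P. is_projection sc Y P}. norm P)"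

definition commutes_with_all ::
  "('s \<Rightarrow> ('x::real_normed_vector \<Rightarrow>\<^sub>L 'x)) \<Rightarrow> ('x \<Rightarrow>\<^sub>L 'x) \<Rightarrow> bool" where
  "commutes_with_all T P \<longleftrightarrow> (\<forall>s. P o\<^sub>L T s = T s o\<^sub>L P)"

definition minimal_projection ::
  "('k \<Rightarrow> 'x \<Rightarrow> 'x) \<Rightarrow> 'x set \<Rightarrow> ('s \<Rightarrow> ('x::real_normed_vector \<Rightarrow>\<^sub>L 'x)) \<Rightarrow>
   ('x \<Rightarrow>\<^sub>L 'x) \<Rightarrow> bool" where
  "minimal_projection sc Y T P0 \<longleftrightarrow>
     is_projection sc Y P0 \<and> commutes_with_all T P0 \<and>
     (\<forall>P. is_projection sc Y P \<and> commutes_with_all T P \<longrightarrow> norm P0 \<le> norm P)"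

text \<open>The product whose supremum over \<open>s\<close> is the quantity \<open>m\<^sub>Y\<close>.\<close>

definition distortion ::
  "'x set \<Rightarrow> ('s \<Rightarrow> ('x::real_normed_vector \<Rightarrow>\<^sub>L 'x)) \<Rightarrow> 's \<Rightarrow> real" where
  "distortion Y T s = norm (T s) * onorm_on Y (inv_into Y (blinfun_apply (T s)))"

definition m_const :: "'x set \<Rightarrow> ('s \<Rightarrow> ('x::real_normed_vector \<Rightarrow>\<^sub>L 'x)) \<Rightarrow> real" where
  "m_const Y T = (SUP s. distortion Y T s)"

end

theory Submission
  imports Defs
begin

text \<open>
  Given a projection \<open>P\<close> of \<open>X\<close> onto \<open>Y\<close>, let \<open>R s\<close> be the inverse of \<open>T s\<close> on \<open>Y\<close>. The
  conjugates \<open>R s \<circ> P \<circ> T s\<close> are projections onto \<open>Y\<close> whose norms are at most the constant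
  \<open>M = m_const Y T\<close> times the norm of \<open>P\<close>. A right invariant mean turns this family into one
  projection \<open>Q\<close>, defined weakly: \<open>\<psi> (Q x)\<close> is the mean of \<open>\<psi> (R s (P (T s x)))\<close> over \<open>s\<close>.
  The norm of \<open>Q\<close> is again at most \<open>M\<close> times that of \<open>P\<close>, and right invariance makes \<open>Q\<close> commute
  with the action (\<open>averaged_projection\<close>). A minimal projection is therefore bounded by \<open>M\<close> times
  the norm of every projection. Once commuting projections exist, one of least norm exists by weak*
  compactness (\<open>minimal_projection_exists\<close>).

  The point \<open>Q x\<close> exists because \<open>Y\<close> is a dual space. The argument works throughout with the
  functionals on \<open>Y\<close> that are weak* continuous on the unit ball, called \<open>bw_continuous\<close> below. They
  are stable under composition with each \<open>T s\<close>, which is weak* continuous on the ball, and every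
  bounded functional on the space of all of them is the evaluation at a point of \<open>Y\<close>
  (\<open>bw_dual_evaluation\<close>). Hence means and filter limits of bounded families in \<open>Y\<close> exist and commute with each \<open>T s\<close>.

  It remains to see that the functions \<open>s \<mapsto> \<psi> (R s (P (T s x)))\<close> lie in the domain of the
  mean. If \<open>T\<close> is continuous in norm, a direct estimate puts them in \<open>C_norm\<close>
  (\<open>orbit_C_norm\<close>). If it is only strongly continuous, one has to know that a bounded functional
  \<open>\<Lambda>\<close> on \<open>C_r\<close> depends continuously on the translate; moving \<open>\<Lambda>\<close> inside \<open>R s\<close> by the
  same weak* argument reduces this to strong continuity at one vector (\<open>orbit_C_weak\<close>). In both
  cases \<open>R s\<close> is continuous in \<open>s\<close> because the finiteness of \<open>M\<close> bounds it locally.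
\<close>


section \<open>Convex sets, cluster points and initial topologies\<close>

lemma bounded_onE:
  assumes "bounded_on V f"
  obtains C where "0 \<le> C" "\<And>x. x \<in> V \<Longrightarrow> norm (f x) \<le> C * norm x"
proof -
  obtain C where C: "\<And>x. x \<in> V \<Longrightarrow> norm (f x) \<le> C * norm x"
    using assms by (auto simp: bounded_on_def)
  have "norm (f x) \<le> \<bar>C\<bar> * norm x" if "x \<in> V" for x
    using C[OF that] by (meson abs_ge_self mult_right_mono norm_ge_zero order_trans)
  then show thesis by (intro that[of "\<bar>C\<bar>"]) auto
qed

text \<open>
  This replaces the Hahn--Banach separation of a convex set from the origin in a Euclidean space
  whose dimension is the size of \<open>I\<close>. Minimising the sum of squares over \<open>D\<close> up to a small
  error avoids both the choice of such a space and any compactness of \<open>D\<close>.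
\<close>

lemma near_zero_of_no_separation:
  fixes \<beta> :: "'i \<Rightarrow> 'a::real_vector \<Rightarrow> real"
  assumes "convex D" and "D \<noteq> {}"
    and affine: "\<And>i u v t. \<lbrakk>i \<in> I; u \<in> D; v \<in> D; 0 \<le> t; t \<le> 1\<rbrakk> \<Longrightarrow>
      \<beta> i ((1 - t) *\<^sub>R u + t *\<^sub>R v) = (1 - t) * \<beta> i u + t * \<beta> i v"
    and bounded: "\<And>y. y \<in> D \<Longrightarrow> (\<Sum>i\<in>I. (\<beta> i y)\<^sup>2) \<le> M"
    and no_separation: "\<And>c b. (\<And>y. y \<in> D \<Longrightarrow> b \<le> (\<Sum>i\<in>I. c i * \<beta> i y)) \<Longrightarrow> b \<le> 0"
    and "0 < \<delta>"
  shows "\<exists>y\<in>D. (\<Sum>i\<in>I. (\<beta> i y)\<^sup>2) < \<delta>"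
proof (rule ccontr)
  define F where "F = (\<lambda>y. \<Sum>i\<in>I. (\<beta> i y)\<^sup>2)"
  define d where "d = Inf (F ` D)"
  assume "\<not> ?thesis"
  then have ge: "\<And>y. y \<in> D \<Longrightarrow> \<delta> \<le> F y"
    by (force simp: F_def not_less)
  have "\<delta> \<le> d"
    unfolding d_def using \<open>D \<noteq> {}\<close> ge by (intro cInf_greatest) auto
  have bdd: "bdd_below (F ` D)"
    using ge by (auto simp: bdd_below_def)
  have d_le: "d \<le> F y" if "y \<in> D" for y
    unfolding d_def using that bdd by (intro cInf_lower) auto
  obtain y1 where "y1 \<in> D" using \<open>D \<noteq> {}\<close> by auto
  have "d \<le> M" using d_le[OF \<open>y1 \<in> D\<close>] bounded[OF \<open>y1 \<in> D\<close>] by (simp add: F_def)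
  have "0 < d" "0 < M" using \<open>\<delta> \<le> d\<close> \<open>d \<le> M\<close> \<open>0 < \<delta>\<close> by auto
  define t where "t = d / (8 * M)"
  have t: "0 < t" "t \<le> 1" using \<open>0 < d\<close> \<open>0 < M\<close> \<open>d \<le> M\<close> by (auto simp: t_def)
  have tM: "4 * M * t\<^sup>2 = t * d / 2" using \<open>0 < M\<close> by (simp add: t_def power2_eq_square)
  obtain y0 where y0: "y0 \<in> D" "F y0 < d + t * d / 2"
    using cInf_lessD[of "F ` D" "d + t * d / 2"] \<open>D \<noteq> {}\<close> t \<open>0 < d\<close> by (auto simp: d_def[symmetric])
  \<comment> \<open>At an almost nearest point the derivative of \<open>F\<close> in the direction of any other point of
    \<open>D\<close> is almost nonnegative, so \<open>\<beta> y0\<close> itself supplies the separating coefficients.\<close>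
  have "d / 2 \<le> (\<Sum>i\<in>I. \<beta> i y0 * \<beta> i y)" if y: "y \<in> D" for y
  proof -
    let ?S = "\<Sum>i\<in>I. \<beta> i y0 * \<beta> i y"
    let ?v = "(1 - t) *\<^sub>R y0 + t *\<^sub>R y"
    have v: "?v \<in> D" using \<open>convex D\<close> y0 y t by (auto simp: convex_def)
    have "F ?v = (\<Sum>i\<in>I. ((1 - t) * \<beta> i y0 + t * \<beta> i y)\<^sup>2)"
      unfolding F_def using y0 y t by (intro sum.cong) (auto simp: affine)
    also have "\<dots> = (\<Sum>i\<in>I. (\<beta> i y0)\<^sup>2 + 2 * t * (\<beta> i y0 * \<beta> i y - (\<beta> i y0)\<^sup>2)
        + t\<^sup>2 * (\<beta> i y - \<beta> i y0)\<^sup>2)"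
      by (intro sum.cong) (auto simp: power2_eq_square algebra_simps)
    also have "\<dots> = F y0 + 2 * t * (?S - F y0) + t\<^sup>2 * (\<Sum>i\<in>I. (\<beta> i y - \<beta> i y0)\<^sup>2)"
      by (simp add: F_def sum.distrib sum_subtractf flip: sum_distrib_left)
    finally have eq: "F ?v = F y0 + 2 * t * (?S - F y0) + t\<^sup>2 * (\<Sum>i\<in>I. (\<beta> i y - \<beta> i y0)\<^sup>2)" .
    have "(\<Sum>i\<in>I. (\<beta> i y - \<beta> i y0)\<^sup>2) \<le> (\<Sum>i\<in>I. 2 * (\<beta> i y)\<^sup>2 + 2 * (\<beta> i y0)\<^sup>2)"
    proof (rule sum_mono)
      fix i
      have "0 \<le> (\<beta> i y + \<beta> i y0)\<^sup>2" by simp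
      then show "(\<beta> i y - \<beta> i y0)\<^sup>2 \<le> 2 * (\<beta> i y)\<^sup>2 + 2 * (\<beta> i y0)\<^sup>2"
        by (simp add: power2_eq_square algebra_simps)
    qed
    also have "\<dots> \<le> 4 * M"
      using bounded[OF y] bounded[OF \<open>y0 \<in> D\<close>] by (simp add: sum.distrib sum_distrib_left[symmetric])
    finally have "t\<^sup>2 * (\<Sum>i\<in>I. (\<beta> i y - \<beta> i y0)\<^sup>2) \<le> t\<^sup>2 * (4 * M)"
      by (intro mult_left_mono) auto
    also have "\<dots> = t * d / 2"
      using tM by (simp only: mult.commute)
    finally have "t\<^sup>2 * (\<Sum>i\<in>I. (\<beta> i y - \<beta> i y0)\<^sup>2) \<le> t * d / 2" .
    then have "d \<le> F y0 + 2 * t * (?S - F y0) + t * d / 2"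
      using d_le[OF v] eq by linarith
    moreover have "2 * t * (?S - F y0) = 2 * t * ?S - 2 * t * F y0"
      by (simp add: algebra_simps)
    moreover have "t * d \<le> t * F y0"
      using d_le[OF \<open>y0 \<in> D\<close>] t by simp
    ultimately have "t * d \<le> t * (2 * ?S)"
      using y0(2) by (simp add: mult.assoc)
    then show ?thesis using t by simp
  qed
  then have "d / 2 \<le> 0" by (rule no_separation)
  then show False using \<open>0 < d\<close> by simp
qed

text \<open>
  A convergent subsequence need not exist for uncountably many bounded sequences, but Tychonoff's
  theorem gives a cluster point, and the traces of its neighbourhoods on the index set form a
  filter along which every sequence converges.
\<close>

lemma simultaneous_limit_filter:
  fixes a :: "nat \<Rightarrow> 'i \<Rightarrow> real"
  assumes "\<And>n i. \<bar>a n i\<bar> \<le> C i"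
  obtains G l where "G \<noteq> bot" "G \<le> sequentially" "\<And>i. ((\<lambda>n. a n i) \<longlongrightarrow> l i) G"
proof -
  let ?K = "PiE UNIV (\<lambda>i. {- C i..C i})"
  have "compactin (product_topology (\<lambda>i. euclidean) UNIV) ?K"
    by (simp add: compactin_PiE)
  then have "compact ?K"
    by (simp add: euclidean_product_topology)
  moreover have "eventually (\<lambda>x. x \<in> ?K) (filtermap a sequentially)"
    unfolding eventually_filtermap
    using assms by (intro always_eventually) (auto simp: abs_le_iff minus_le_iff)
  moreover have "filtermap a sequentially \<noteq> bot"
    by (simp add: filtermap_bot_iff)
  ultimately obtain l where l: "inf (nhds l) (filtermap a sequentially) \<noteq> bot"
    unfolding compact_filter by blast
  define G where "G = inf (filtercomap a (nhds l)) sequentially"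
  show thesis
  proof (rule that)
    show "G \<noteq> bot"
    proof
      assume "G = bot"
      then have "eventually (\<lambda>_. False) G" by simp
      then obtain P Q where PQ: "eventually P (filtercomap a (nhds l))" "eventually Q sequentially"
          "\<And>n. P n \<Longrightarrow> Q n \<Longrightarrow> False"
        by (auto simp: G_def eventually_inf)
      then obtain P' where P': "eventually P' (nhds l)" "\<And>n. P' (a n) \<Longrightarrow> P n"
        by (auto simp: eventually_filtercomap)
      have "eventually (\<lambda>x. \<not> P' x) (filtermap a sequentially)"
        using PQ(2) by (auto simp: eventually_filtermap elim!: eventually_mono dest: PQ(3) P'(2))
      with P'(1) have "eventually (\<lambda>_. False) (inf (nhds l) (filtermap a sequentially))"
        by (auto simp: eventually_inf)
      with l show False by (simp add: trivial_limit_def)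
    qed
    show "G \<le> sequentially" by (simp add: G_def)
    have lim: "filterlim a (nhds l) G"
      by (simp add: G_def filterlim_def filtermap_filtercomap filtermap_inf le_infI1
          order_trans[OF filtermap_mono[OF inf_le1]])
    show "((\<lambda>n. a n i) \<longlongrightarrow> l i) G" for i
    proof (rule topological_tendstoI)
      fix S :: "real set" assume "open S" "l i \<in> S"
      then have "open ((\<lambda>x. x i) -` S)"
        by (intro open_vimage continuous_on_product_coordinates)
      then have "eventually (\<lambda>x. x i \<in> S) (nhds l)"
        using \<open>l i \<in> S\<close> by (auto simp: eventually_nhds intro!: exI[of _ "(\<lambda>x. x i) -` S"])
      then show "eventually (\<lambda>n. a n i \<in> S) G"
        by (rule lim[unfolded filterlim_iff, rule_format])
    qed
  qed
qed

text \<open>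
  Induction over the generation of the topology by its subbasis: intersections merge the finite
  index sets and take the smaller radius.
\<close>

lemma initial_topology_nhd_zero:
  fixes f :: "'i \<Rightarrow> 'a \<Rightarrow> 'b::real_normed_vector"
  assumes "openin (initial_topology A (range f)) U" and "x0 \<in> U" and "\<And>i. f i x0 = 0"
  shows "\<exists>I \<delta>. finite I \<and> 0 < \<delta> \<and> {x \<in> A. \<forall>i\<in>I. norm (f i x) < \<delta>} \<subseteq> U"
proof -
  have "generate_topology_on {{x \<in> A. g x \<in> V} | g V. g \<in> range f \<and> open V} U"
    using assms(1) by (simp add: initial_topology_def openin_topology_generated_by_iff)
  then show ?thesis using \<open>x0 \<in> U\<close>
  proof (induction rule: generate_topology_on.induct)
    case Empty
    then show ?case by simp
  next
    case (Int a b)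
    then obtain I1 \<delta>1 I2 \<delta>2 where
      "finite I1 \<and> 0 < \<delta>1 \<and> {x \<in> A. \<forall>i\<in>I1. norm (f i x) < \<delta>1} \<subseteq> a"
      "finite I2 \<and> 0 < \<delta>2 \<and> {x \<in> A. \<forall>i\<in>I2. norm (f i x) < \<delta>2} \<subseteq> b" by auto
    then show ?case
      by (intro exI[of _ "I1 \<union> I2"] exI[of _ "min \<delta>1 \<delta>2"]) auto
  next
    case (UN K)
    then obtain k where k: "k \<in> K" "x0 \<in> k" by auto
    show ?case using UN.IH[OF k] k(1) by blast
  next
    case (Basis s)
    then obtain i V where s: "s = {x \<in> A. f i x \<in> V}" "open V" by auto
    then have "0 \<in> V" using Basis assms(3) by force
    then obtain e where "0 < e" "ball 0 e \<subseteq> V" using \<open>open V\<close> by (meson open_contains_ball)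
    then show ?case
      by (intro exI[of _ "{i}"] exI[of _ e]) (auto simp: s)
  qed
qed

lemma continuous_map_initial_topologyI:
  assumes g: "\<And>s. g s \<in> A" and cont: "\<And>f. f \<in> F \<Longrightarrow> continuous_on UNIV (\<lambda>s. f (g s))" and "F \<noteq> {}"
  shows "continuous_map euclidean (initial_topology A F) g"
  unfolding initial_topology_def
proof (rule continuous_on_generated_topo)
  fix W assume "W \<in> {{x \<in> A. f x \<in> U} | f U. f \<in> F \<and> open U}"
  then obtain f U where W: "W = {x \<in> A. f x \<in> U}" "f \<in> F" "open U"
    unfolding mem_Collect_eq by (elim exE conjE) (rule that)
  have "g -` W = (\<lambda>s. f (g s)) -` U" using g by (auto simp: W)
  moreover have "open ((\<lambda>s. f (g s)) -` U)" by (intro open_vimage W cont)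
  ultimately show "openin euclidean (g -` W \<inter> topspace euclidean)" by simp
next
  obtain f where "f \<in> F" using \<open>F \<noteq> {}\<close> by auto
  then have "A \<in> {{x \<in> A. f x \<in> U} | f U. f \<in> F \<and> open U}"
    by (intro CollectI exI[of _ f] exI[of _ UNIV]) auto
  then show "g ` topspace euclidean \<subseteq> \<Union> {{x \<in> A. f x \<in> U} | f U. f \<in> F \<and> open U}"
    using g by (intro image_subsetI UnionI)
qed


section \<open>Functionals on a dual space that are weak* continuous on bounded sets\<close>

locale dual_subspace = X: banach_space_over scaleX + Z: banach_space_over scaleZ
  for scaleX :: "'k::{real_normed_field,euclidean_space} \<Rightarrow> 'x::banach \<Rightarrow> 'x"
    and scaleZ :: "'k \<Rightarrow> 'z::banach \<Rightarrow> 'z" +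
  fixes Y :: "'x set" and J :: "'x \<Rightarrow> ('z \<Rightarrow>\<^sub>L 'k)"
  assumes subspace_Y: "X.subspace Y"
    and isometry_J: "dual_isometry scaleX Y scaleZ J"
begin

lemma zero_mem: "0 \<in> Y"
  and add_mem: "u \<in> Y \<Longrightarrow> v \<in> Y \<Longrightarrow> u + v \<in> Y"
  and scale_mem: "u \<in> Y \<Longrightarrow> scaleX a u \<in> Y"
  and diff_mem: "u \<in> Y \<Longrightarrow> v \<in> Y \<Longrightarrow> u - v \<in> Y"
  using subspace_Y by (auto simp: X.subspace_def intro: X.subspace_diff[OF subspace_Y])

lemma scaleR_mem: "u \<in> Y \<Longrightarrow> r *\<^sub>R u \<in> Y"
  using scale_mem[of u "of_real r"] by (simp add: X.scale_of_real)

lemma convex_Y: "convex Y"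
  by (simp add: convex_def add_mem scaleR_mem)

lemma J_add: "u \<in> Y \<Longrightarrow> v \<in> Y \<Longrightarrow> J (u + v) z = J u z + J v z"
  and J_scale: "u \<in> Y \<Longrightarrow> J (scaleX a u) z = a * J u z"
  and norm_J: "u \<in> Y \<Longrightarrow> norm (J u) = norm u"
  using isometry_J by (auto simp: dual_isometry_def linear_on_def)

lemma J_arg_scale: "u \<in> Y \<Longrightarrow> J u (scaleZ a z) = a * J u z"
  using isometry_J bij_betwE[of J Y "dual_space scaleZ"]
  by (auto simp: dual_isometry_def dual_space_def linear_on_def)

lemma J_scaleR: "u \<in> Y \<Longrightarrow> J (r *\<^sub>R u) z = r *\<^sub>R J u z"
  using J_scale[of u "of_real r" z] by (simp add: X.scale_of_real scaleR_conv_of_real)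

lemma J_diff: "u \<in> Y \<Longrightarrow> v \<in> Y \<Longrightarrow> J (u - v) z = J u z - J v z"
  using J_add[of "u - v" v z] diff_mem[of u v] by simp

lemma J_zero: "J 0 z = 0"
  using J_scaleR[OF zero_mem, of 0 z] by simp

lemma norm_J_le: "u \<in> Y \<Longrightarrow> norm (J u z) \<le> norm u * norm z"
  using norm_blinfun[of "J u" z] norm_J by simp

lemma J_surj:
  assumes "linear_on scaleZ (*) UNIV (blinfun_apply g)"
  obtains y where "y \<in> Y" "J y = g"
  using isometry_J assms by (force simp: dual_isometry_def bij_betw_def dual_space_def)

text \<open>
  These are the real-linear functionals on \<open>Y\<close> whose restriction to the unit ball is weak*
  continuous, with the continuity at \<open>0\<close> stated quantitatively. In this form sums and composites
  are handled by estimates on all of \<open>Y\<close>, and in a bounded subset of \<open>Y\<close> the value is small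
  wherever finitely many evaluations are small. By the Krein--Smulian theorem they are the real parts of
  evaluations at points of the predual; the weaker description suffices here, and it is the one
  that a map which is weak* continuous only on the ball respects.
\<close>

definition bw_continuous :: "('x \<Rightarrow> real) \<Rightarrow> bool" where
  "bw_continuous \<psi> \<longleftrightarrow> linear_on scaleR scaleR Y \<psi> \<and>
     (\<forall>\<epsilon>>0. \<exists>F C. finite F \<and> 0 \<le> C \<and> (\<forall>y\<in>Y. \<bar>\<psi> y\<bar> \<le> \<epsilon> * norm y + C * (\<Sum>z\<in>F. norm (J y z))))"

lemma bw_continuous_linear: "bw_continuous \<psi> \<Longrightarrow> linear_on scaleR scaleR Y \<psi>"
  by (simp add: bw_continuous_def)

lemma bw_continuousE:
  assumes "bw_continuous \<psi>" "0 < \<epsilon>"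
  obtains F C where "finite F" "0 \<le> C" "\<And>y. y \<in> Y \<Longrightarrow> \<bar>\<psi> y\<bar> \<le> \<epsilon> * norm y + C * (\<Sum>z\<in>F. norm (J y z))"
  using assms unfolding bw_continuous_def by meson

lemma bw_continuous_bounded:
  assumes "bw_continuous \<psi>"
  shows "bounded_on Y \<psi>"
proof -
  obtain F C where FC: "finite F" "0 \<le> C"
      "\<And>y. y \<in> Y \<Longrightarrow> \<bar>\<psi> y\<bar> \<le> 1 * norm y + C * (\<Sum>z\<in>F. norm (J y z))"
    using bw_continuousE[OF assms, of 1] by auto
  have "\<bar>\<psi> y\<bar> \<le> (1 + C * (\<Sum>z\<in>F. norm z)) * norm y" if "y \<in> Y" for y
  proof -
    have "(\<Sum>z\<in>F. norm (J y z)) \<le> (\<Sum>z\<in>F. norm y * norm z)"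
      by (intro sum_mono norm_J_le that)
    then have "C * (\<Sum>z\<in>F. norm (J y z)) \<le> C * (\<Sum>z\<in>F. norm y * norm z)"
      using FC(2) by (rule mult_left_mono)
    then show ?thesis using FC(3)[OF that] by (simp add: sum_distrib_left algebra_simps)
  qed
  then show ?thesis by (auto simp: bounded_on_def)
qed

lemma bw_continuous_add:
  assumes "bw_continuous \<psi>" "bw_continuous \<theta>"
  shows "bw_continuous (\<lambda>y. \<psi> y + \<theta> y)"
  unfolding bw_continuous_def
proof (intro conjI allI impI)
  show "linear_on scaleR scaleR Y (\<lambda>y. \<psi> y + \<theta> y)"
    using assms by (auto simp: bw_continuous_def linear_on_def algebra_simps)
  fix \<epsilon> :: real assume "0 < \<epsilon>"
  then have e2: "0 < \<epsilon> / 2" by simp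
  obtain F C where 1: "finite F" "0 \<le> C" "\<And>y. y \<in> Y \<Longrightarrow> \<bar>\<psi> y\<bar> \<le> \<epsilon> / 2 * norm y + C * (\<Sum>z\<in>F. norm (J y z))"
    using bw_continuousE[OF assms(1) e2] by metis
  obtain F' C' where 2: "finite F'" "0 \<le> C'"
      "\<And>y. y \<in> Y \<Longrightarrow> \<bar>\<theta> y\<bar> \<le> \<epsilon> / 2 * norm y + C' * (\<Sum>z\<in>F'. norm (J y z))"
    using bw_continuousE[OF assms(2) e2] by metis
  show "\<exists>F C. finite F \<and> 0 \<le> C \<and> (\<forall>y\<in>Y. \<bar>\<psi> y + \<theta> y\<bar> \<le> \<epsilon> * norm y + C * (\<Sum>z\<in>F. norm (J y z)))"
  proof (intro exI conjI ballI)
    fix y assume y: "y \<in> Y"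
    have "(\<Sum>z\<in>F. norm (J y z)) \<le> (\<Sum>z\<in>F \<union> F'. norm (J y z))"
      and "(\<Sum>z\<in>F'. norm (J y z)) \<le> (\<Sum>z\<in>F \<union> F'. norm (J y z))"
      using 1 2 by (auto intro!: sum_mono2)
    then have "C * (\<Sum>z\<in>F. norm (J y z)) \<le> C * (\<Sum>z\<in>F \<union> F'. norm (J y z))"
      and "C' * (\<Sum>z\<in>F'. norm (J y z)) \<le> C' * (\<Sum>z\<in>F \<union> F'. norm (J y z))"
      using 1 2 by (auto intro: mult_left_mono)
    then show "\<bar>\<psi> y + \<theta> y\<bar> \<le> \<epsilon> * norm y + (C + C') * (\<Sum>z\<in>F \<union> F'. norm (J y z))"
      using 1(3)[OF y] 2(3)[OF y] unfolding distrib_right by linarith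
  qed (use 1 2 in auto)
qed

text \<open>
  After scaling \<open>y\<close> to norm \<open>1\<close>, either all evaluations are small and the assumption gives the term
  \<open>\<epsilon> * norm y\<close>, or one of them is at least \<open>\<delta> * norm y\<close> and a large multiple of it
  dominates \<open>\<bar>\<psi> y\<bar>\<close> because \<open>\<psi>\<close> is bounded.
\<close>

lemma bw_continuousI:
  assumes lin: "linear_on scaleR scaleR Y \<psi>" and bdd: "bounded_on Y \<psi>"
    and nhd: "\<And>\<epsilon>. 0 < \<epsilon> \<Longrightarrow> \<exists>F \<delta>. finite F \<and> 0 < \<delta> \<and>
      (\<forall>y\<in>Y. norm y \<le> 1 \<longrightarrow> (\<forall>z\<in>F. norm (J y z) < \<delta>) \<longrightarrow> \<bar>\<psi> y\<bar> \<le> \<epsilon>)"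
  shows "bw_continuous \<psi>"
  unfolding bw_continuous_def
proof (intro conjI allI impI lin)
  fix \<epsilon> :: real assume "0 < \<epsilon>"
  then obtain F \<delta> where F: "finite F" "0 < \<delta>"
      and small: "\<And>y. y \<in> Y \<Longrightarrow> norm y \<le> 1 \<Longrightarrow> (\<forall>z\<in>F. norm (J y z) < \<delta>) \<Longrightarrow> \<bar>\<psi> y\<bar> \<le> \<epsilon>"
    using nhd[of \<epsilon>] by auto
  obtain B where B: "0 \<le> B" "\<And>y. y \<in> Y \<Longrightarrow> \<bar>\<psi> y\<bar> \<le> B * norm y"
    using bounded_onE[OF bdd] by auto
  define C where "C = B / \<delta>"
  show "\<exists>F C. finite F \<and> 0 \<le> C \<and> (\<forall>y\<in>Y. \<bar>\<psi> y\<bar> \<le> \<epsilon> * norm y + C * (\<Sum>z\<in>F. norm (J y z)))"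
  proof (intro exI conjI ballI)
    fix y assume y: "y \<in> Y"
    show "\<bar>\<psi> y\<bar> \<le> \<epsilon> * norm y + C * (\<Sum>z\<in>F. norm (J y z))"
    proof (cases "\<forall>z\<in>F. norm (J y z) < \<delta> * norm y")
      case True
      show ?thesis
      proof (cases "y = 0")
        case True
        then show ?thesis using B(2)[OF y] B(1) F by (simp add: C_def sum_nonneg)
      next
        case False
        define u where "u = (1 / norm y) *\<^sub>R y"
        have "u \<in> Y" using y by (simp add: u_def scaleR_mem)
        moreover have "norm u \<le> 1" by (simp add: u_def)
        moreover have "\<forall>z\<in>F. norm (J u z) < \<delta>"
          using True False y by (auto simp: u_def J_scaleR divide_simps mult.commute)
        ultimately have "\<bar>\<psi> u\<bar> \<le> \<epsilon>" by (rule small)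
        moreover have "\<psi> u = \<psi> y / norm y"
          using lin y by (simp add: linear_on_def u_def)
        ultimately have "\<bar>\<psi> y\<bar> \<le> \<epsilon> * norm y"
          using False by (simp add: divide_simps)
        moreover have "0 \<le> C * (\<Sum>z\<in>F. norm (J y z))"
          using B(1) F by (simp add: C_def sum_nonneg)
        ultimately show ?thesis by linarith
      qed
    next
      case False
      then obtain z where z: "z \<in> F" "\<delta> * norm y \<le> norm (J y z)" by (auto simp: not_less)
      then have "\<delta> * norm y \<le> (\<Sum>z\<in>F. norm (J y z))"
        using member_le_sum[of z F "\<lambda>z. norm (J y z)"] F by simp
      then have "C * (\<delta> * norm y) \<le> C * (\<Sum>z\<in>F. norm (J y z))"
        using B(1) F by (intro mult_left_mono) (auto simp: C_def)
      moreover have "C * (\<delta> * norm y) = B * norm y" using F by (simp add: C_def)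
      moreover note B(2)[OF y]
      moreover have "0 \<le> \<epsilon> * norm y" using \<open>0 < \<epsilon>\<close> by simp
      ultimately show ?thesis by linarith
    qed
  qed (use B(1) F in \<open>auto simp: C_def\<close>)
qed

lemma bw_continuous_J: "bw_continuous (\<lambda>y. J y z \<bullet> b)"
  unfolding bw_continuous_def
proof (intro conjI allI impI)
  show "linear_on scaleR scaleR Y (\<lambda>y. J y z \<bullet> b)"
    by (auto simp: linear_on_def J_add J_scaleR inner_add_left)
  fix \<epsilon> :: real assume "0 < \<epsilon>"
  have "\<bar>J y z \<bullet> b\<bar> \<le> \<epsilon> * norm y + norm b * (\<Sum>z\<in>{z}. norm (J y z))" for y
  proof -
    have "0 \<le> \<epsilon> * norm y" using \<open>0 < \<epsilon>\<close> by simp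
    then show ?thesis using Cauchy_Schwarz_ineq2[of "J y z" b] by (simp add: mult.commute)
  qed
  then show "\<exists>F C. finite F \<and> 0 \<le> C \<and>
      (\<forall>y\<in>Y. \<bar>J y z \<bullet> b\<bar> \<le> \<epsilon> * norm y + C * (\<Sum>z\<in>F. norm (J y z)))"
    by (intro exI[of _ "{z}"] exI[of _ "norm b"]) auto
qed

text \<open>
  The finitely many evaluations that control \<open>\<psi>\<close> at \<open>A y\<close> are bounded by their
  coordinates, and each coordinate is by assumption controlled at \<open>y\<close>. Restricting to the unit
  ball leaves only the bookkeeping of one common radius.
\<close>

lemma bw_continuous_compose:
  assumes A_mem: "\<And>y. y \<in> Y \<Longrightarrow> A y \<in> Y" and A_lin: "linear_on scaleR scaleR Y A"
    and A_bdd: "bounded_on Y A"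
    and A_J: "\<And>z b. bw_continuous (\<lambda>y. J (A y) z \<bullet> b)"
    and \<psi>: "bw_continuous \<psi>"
  shows "bw_continuous (\<lambda>y. \<psi> (A y))"
proof (rule bw_continuousI)
  show lin: "linear_on scaleR scaleR Y (\<lambda>y. \<psi> (A y))"
    using A_lin bw_continuous_linear[OF \<psi>] by (auto simp: linear_on_def A_mem)
  obtain M where M: "0 \<le> M" "\<And>y. y \<in> Y \<Longrightarrow> norm (A y) \<le> M * norm y"
    using bounded_onE[OF A_bdd] by auto
  obtain N where N: "0 \<le> N" "\<And>y. y \<in> Y \<Longrightarrow> \<bar>\<psi> y\<bar> \<le> N * norm y"
    using bounded_onE[OF bw_continuous_bounded[OF \<psi>]] by auto
  have "\<bar>\<psi> (A y)\<bar> \<le> (N * M) * norm y" if y: "y \<in> Y" for y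
    using N(2)[OF A_mem[OF y]] mult_left_mono[OF M(2)[OF y] N(1)] by (simp add: mult.assoc)
  then show "bounded_on Y (\<lambda>y. \<psi> (A y))" by (auto simp: bounded_on_def)
  fix \<epsilon> :: real assume "0 < \<epsilon>"
  define \<epsilon>' where "\<epsilon>' = \<epsilon> / (2 * (M + 1))"
  have e': "0 < \<epsilon>'" "\<epsilon>' * (M + 1) = \<epsilon> / 2" using \<open>0 < \<epsilon>\<close> M(1) by (auto simp: \<epsilon>'_def divide_simps)
  obtain F C where F: "finite F" "0 \<le> C" "\<And>y. y \<in> Y \<Longrightarrow> \<bar>\<psi> y\<bar> \<le> \<epsilon>' * norm y + C * (\<Sum>z\<in>F. norm (J y z))"
    using bw_continuousE[OF \<psi> e'(1)] by metis
  define I where "I = F \<times> (Basis :: 'k set)"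
  have I: "finite I" using F by (simp add: I_def)
  define \<eta> where "\<eta> = \<epsilon> / (4 * (C + 1) * (real (card I) + 1))"
  have eta: "0 < \<eta>" using \<open>0 < \<epsilon>\<close> F by (simp add: \<eta>_def)
  have eta': "C * (real (card I) * (2 * \<eta>)) \<le> \<epsilon> / 2"
  proof -
    have "C * (real (card I) * (2 * \<eta>)) \<le> (C + 1) * ((real (card I) + 1) * (2 * \<eta>))"
      using F eta by (intro mult_mono) auto
    also have "\<dots> = \<epsilon> / 2"
      using F by (simp add: \<eta>_def divide_simps)
    finally show ?thesis .
  qed
  have "\<exists>G D. finite G \<and> 0 \<le> D \<and>
      (\<forall>y\<in>Y. \<bar>J (A y) (fst p) \<bullet> snd p\<bar> \<le> \<eta> * norm y + D * (\<Sum>z\<in>G. norm (J y z)))" for p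
    using A_J eta unfolding bw_continuous_def by simp
  then obtain G D where GD: "\<And>p. finite (G p)" "\<And>p. 0 \<le> D p"
      "\<And>p y. y \<in> Y \<Longrightarrow> \<bar>J (A y) (fst p) \<bullet> snd p\<bar> \<le> \<eta> * norm y + D p * (\<Sum>z\<in>G p. norm (J y z))"
    by metis
  define H where "H = (\<Union>p\<in>I. G p)"
  define E where "E = (\<Sum>p\<in>I. D p)"
  define \<delta> where "\<delta> = \<eta> / ((E + 1) * (real (card H) + 1))"
  have "0 \<le> E" by (simp add: E_def GD sum_nonneg)
  have H: "finite H" using I GD by (simp add: H_def)
  show "\<exists>F \<delta>. finite F \<and> 0 < \<delta> \<and>
      (\<forall>y\<in>Y. norm y \<le> 1 \<longrightarrow> (\<forall>z\<in>F. norm (J y z) < \<delta>) \<longrightarrow> \<bar>\<psi> (A y)\<bar> \<le> \<epsilon>)"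
  proof (intro exI conjI ballI impI)
    show "finite H" by fact
    show d: "0 < \<delta>" using eta \<open>0 \<le> E\<close> by (simp add: \<delta>_def)
    fix y assume y: "y \<in> Y" "norm y \<le> 1" "\<forall>z\<in>H. norm (J y z) < \<delta>"
    have coord: "\<bar>J (A y) (fst p) \<bullet> snd p\<bar> \<le> 2 * \<eta>" if p: "p \<in> I" for p
    proof -
      have "(\<Sum>z\<in>G p. norm (J y z)) \<le> (\<Sum>z\<in>H. norm (J y z))"
        using p H by (intro sum_mono2) (auto simp: H_def)
      also have "\<dots> \<le> (\<Sum>z\<in>H. \<delta>)"
        using y(3) by (intro sum_mono) (auto intro: less_imp_le)
      finally have s: "(\<Sum>z\<in>G p. norm (J y z)) \<le> (real (card H) + 1) * \<delta>"
        using d by (simp add: algebra_simps)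
      have "D p \<le> E + 1"
        using member_le_sum[of p I D] p I GD by (simp add: E_def)
      then have "D p * (\<Sum>z\<in>G p. norm (J y z)) \<le> (E + 1) * ((real (card H) + 1) * \<delta>)"
        using s GD \<open>0 \<le> E\<close> by (intro mult_mono) (auto simp: sum_nonneg)
      also have "\<dots> = \<eta>" using \<open>0 \<le> E\<close> by (simp add: \<delta>_def)
      moreover have "\<eta> * norm y \<le> \<eta>" using eta y by (simp add: mult_left_le)
      ultimately show ?thesis using GD(3)[OF y(1), of p] by linarith
    qed
    have "(\<Sum>z\<in>F. norm (J (A y) z)) \<le> (\<Sum>z\<in>F. \<Sum>b\<in>Basis. \<bar>J (A y) z \<bullet> b\<bar>)"
      by (intro sum_mono norm_le_l1)
    also have "\<dots> = (\<Sum>p\<in>I. \<bar>J (A y) (fst p) \<bullet> snd p\<bar>)"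
      by (simp add: I_def sum.cartesian_product split_def)
    also have "\<dots> \<le> (\<Sum>p\<in>I. 2 * \<eta>)"
      by (intro sum_mono coord)
    finally have "(\<Sum>z\<in>F. norm (J (A y) z)) \<le> real (card I) * (2 * \<eta>)" by simp
    then have "C * (\<Sum>z\<in>F. norm (J (A y) z)) \<le> \<epsilon> / 2"
      using F eta' by (meson mult_left_mono order_trans)
    moreover have "\<epsilon>' * norm (A y) \<le> \<epsilon> / 2"
    proof -
      have "norm (A y) \<le> M * norm y" by (rule M(2)[OF y(1)])
      also have "\<dots> \<le> M + 1" using mult_left_mono[OF y(2), of M] M(1) by simp
      finally have "\<epsilon>' * norm (A y) \<le> \<epsilon>' * (M + 1)" using e'(1) by (intro mult_left_mono) auto
      then show ?thesis using e'(2) by simp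
    qed
    ultimately show "\<bar>\<psi> (A y)\<bar> \<le> \<epsilon>" using F(3)[OF A_mem[OF y(1)]] by linarith
  qed
qed

lemma bw_continuous_scale:
  assumes "bw_continuous \<psi>"
  shows "bw_continuous (\<lambda>y. \<psi> (scaleX a y))"
proof (rule bw_continuous_compose[OF _ _ _ _ assms])
  show "linear_on scaleR scaleR Y (scaleX a)"
    by (auto simp: linear_on_def X.scale_right_distrib mult.commute simp flip: X.scale_of_real)
  show "bounded_on Y (scaleX a)"
    by (auto simp: bounded_on_def X.norm_scale)
  show "bw_continuous (\<lambda>y. J (scaleX a y) z \<bullet> b)" for z b
  proof -
    \<comment> \<open>A coordinate of a product with a scalar is again a coordinate, for a rotated and scaled
      direction; this lets real functionals detect linearity over \<open>'k\<close>.\<close>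
    have "linear ((*) a)" by (simp add: linear_iff algebra_simps)
    then have "J (scaleX a y) z \<bullet> b = J y z \<bullet> adjoint ((*) a) b" if "y \<in> Y" for y
      using that by (simp add: J_scale adjoint_works)
    with bw_continuous_J[of z "adjoint ((*) a) b"] show ?thesis
      unfolding bw_continuous_def linear_on_def by (simp add: add_mem scaleR_mem)
  qed
qed (rule scale_mem)

lemma bw_continuous_scaleR: "bw_continuous \<psi> \<Longrightarrow> bw_continuous (\<lambda>y. r * \<psi> y)"
proof -
  assume \<psi>: "bw_continuous \<psi>"
  have "\<psi> (scaleX (of_real r) y) = r * \<psi> y" if "y \<in> Y" for y
    using bw_continuous_linear[OF \<psi>] that by (simp add: X.scale_of_real linear_on_def)
  with bw_continuous_scale[OF \<psi>, of "of_real r"] show ?thesis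
    unfolding bw_continuous_def linear_on_def by (simp add: add_mem scaleR_mem)
qed

lemma bw_continuous_sum:
  assumes "finite I" "\<And>i. i \<in> I \<Longrightarrow> bw_continuous (\<psi> i)"
  shows "bw_continuous (\<lambda>y. \<Sum>i\<in>I. \<psi> i y)"
  using assms
proof (induction I rule: finite_induct)
  case empty
  show ?case using bw_continuous_J[of 0 0] by simp
next
  case (insert i I)
  then show ?case by (simp add: bw_continuous_add)
qed

text \<open>
  Continuity at \<open>0\<close> alone is used: the preimage of a weak* neighbourhood of \<open>0\<close> contains the trace
  on the ball of a basic neighbourhood, which is the hypothesis of \<open>bw_continuousI\<close>.
\<close>

lemma bw_continuous_J_compose:
  assumes A_mem: "\<And>y. y \<in> Y \<Longrightarrow> A y \<in> Y" and A_lin: "linear_on scaleR scaleR Y A"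
    and A_bdd: "bounded_on Y A"
    and A_cont: "continuous_map (subtopology (weak_star_topology Y J) {y\<in>Y. norm y \<le> 1})
      (weak_star_topology Y J) A"
  shows "bw_continuous (\<lambda>y. J (A y) z \<bullet> b)"
proof (rule bw_continuousI)
  show "linear_on scaleR scaleR Y (\<lambda>y. J (A y) z \<bullet> b)"
    using A_lin by (auto simp: linear_on_def A_mem J_add J_scaleR inner_add_left)
  then have A0: "A 0 = 0"
    using A_lin zero_mem unfolding linear_on_def by (metis scaleR_zero_left)
  obtain M where M: "\<And>y. y \<in> Y \<Longrightarrow> norm (A y) \<le> M * norm y"
    using A_bdd by (auto simp: bounded_on_def)
  have "\<bar>J (A y) z \<bullet> b\<bar> \<le> (M * norm z * norm b) * norm y" if y: "y \<in> Y" for y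
  proof -
    have "\<bar>J (A y) z \<bullet> b\<bar> \<le> norm (J (A y) z) * norm b" by (rule Cauchy_Schwarz_ineq2)
    also have "\<dots> \<le> (norm (A y) * norm z) * norm b"
      by (intro mult_right_mono norm_J_le A_mem y) auto
    also have "\<dots> \<le> ((M * norm y) * norm z) * norm b"
      by (intro mult_right_mono M y) auto
    finally show ?thesis by (simp add: ac_simps)
  qed
  then show "bounded_on Y (\<lambda>y. J (A y) z \<bullet> b)" by (auto simp: bounded_on_def)
  fix \<epsilon> :: real assume "0 < \<epsilon>"
  let ?W = "{y \<in> Y. J y z \<in> {k. \<bar>k \<bullet> b\<bar> < \<epsilon>}}"
  have "open {k::'k. \<bar>k \<bullet> b\<bar> < \<epsilon>}"
    by (intro open_Collect_less continuous_intros)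
  then have "openin (weak_star_topology Y J) ?W"
    unfolding weak_star_topology_def initial_topology_def
    by (intro topology_generated_by_Basis CollectI exI[of _ "\<lambda>y. J y z"] exI[of _ "{k. \<bar>k \<bullet> b\<bar> < \<epsilon>}"]) auto
  then have "openin (subtopology (weak_star_topology Y J) {y\<in>Y. norm y \<le> 1})
      {y \<in> topspace (subtopology (weak_star_topology Y J) {y\<in>Y. norm y \<le> 1}). A y \<in> ?W}"
    using A_cont by (auto simp: continuous_map_def)
  then obtain U where U: "openin (weak_star_topology Y J) U"
      "{y \<in> topspace (subtopology (weak_star_topology Y J) {y\<in>Y. norm y \<le> 1}). A y \<in> ?W}
        = U \<inter> {y\<in>Y. norm y \<le> 1}"
    unfolding openin_subtopology by blast
  have top: "topspace (weak_star_topology Y J) = Y"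
    unfolding weak_star_topology_def initial_topology_def topology_generated_by_topspace
    by (auto intro!: exI[of _ UNIV])
  have U': "y \<in> U \<longleftrightarrow> A y \<in> ?W" if "y \<in> Y" "norm y \<le> 1" for y
    using that U(2) by (auto simp: top)
  have "0 \<in> U" using U'[of 0] \<open>0 < \<epsilon>\<close> by (simp add: zero_mem A0 J_zero)
  then obtain F \<delta> where F: "finite F" "0 < \<delta>" "{y \<in> Y. \<forall>z\<in>F. norm (J y z) < \<delta>} \<subseteq> U"
    using initial_topology_nhd_zero[of Y "\<lambda>z y. J y z" U 0] U(1)
    by (auto simp: weak_star_topology_def J_zero)
  then show "\<exists>F \<delta>. finite F \<and> 0 < \<delta> \<and>
      (\<forall>y\<in>Y. norm y \<le> 1 \<longrightarrow> (\<forall>z\<in>F. norm (J y z) < \<delta>) \<longrightarrow> \<bar>J (A y) z \<bullet> b\<bar> \<le> \<epsilon>)"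
    using U' by (intro exI[of _ F] exI[of _ \<delta>]) (fastforce intro: less_imp_le)
qed

section \<open>Generalized limits in a dual space\<close>

lemma eq_if_bw_equal:
  assumes "u \<in> Y" "v \<in> Y" "\<And>\<psi>. bw_continuous \<psi> \<Longrightarrow> \<psi> u = \<psi> v"
  shows "u = v"
proof -
  have "J u z = J v z" for z
    using assms(3)[OF bw_continuous_J] by (metis euclidean_eqI)
  then have "J u = J v" by (rule blinfun_eqI)
  then show ?thesis
    using isometry_J assms by (auto simp: dual_isometry_def bij_betw_def inj_on_def)
qed

text \<open>
  This is Helly's theorem. If no point of the ball of radius \<open>K\<close> had nearly the prescribed values,
  some combination \<open>\<theta>\<close> of the functionals in \<open>I\<close> would separate them from the values
  on the ball, so its norm times \<open>K\<close> would be smaller than \<open>\<bar>L \<theta>\<bar>\<close>.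
\<close>

lemma bw_functional_approximation:
  assumes L_add: "\<And>\<psi> \<theta>. bw_continuous \<psi> \<Longrightarrow> bw_continuous \<theta> \<Longrightarrow> L (\<lambda>y. \<psi> y + \<theta> y) = L \<psi> + L \<theta>"
    and L_scale: "\<And>\<psi> r. bw_continuous \<psi> \<Longrightarrow> L (\<lambda>y. r * \<psi> y) = r * L \<psi>"
    and L_bound: "\<And>\<psi> B. bw_continuous \<psi> \<Longrightarrow> 0 \<le> B \<Longrightarrow> (\<And>y. y \<in> Y \<Longrightarrow> \<bar>\<psi> y\<bar> \<le> B * norm y) \<Longrightarrow> \<bar>L \<psi>\<bar> \<le> K * B"
    and "0 < K" and "finite I" and I: "\<And>\<psi>. \<psi> \<in> I \<Longrightarrow> bw_continuous \<psi>" and "0 < \<delta>"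
  obtains y where "y \<in> Y" "norm y \<le> K" "\<And>\<psi>. \<psi> \<in> I \<Longrightarrow> \<bar>\<psi> y - L \<psi>\<bar> < \<delta>"
proof -
  have bw0: "bw_continuous (\<lambda>_. 0)" using bw_continuous_J[of 0 0] by simp
  have L0: "L (\<lambda>_. 0) = 0" using L_scale[OF bw0, of 0] by simp
  let ?D = "{y \<in> Y. norm y \<le> K}"
  have "\<exists>B. \<forall>y\<in>?D. (\<psi> y - L \<psi>)\<^sup>2 \<le> B" if \<psi>: "\<psi> \<in> I" for \<psi>
  proof -
    obtain N where N: "0 \<le> N" "\<And>y. y \<in> Y \<Longrightarrow> \<bar>\<psi> y\<bar> \<le> N * norm y"
      using bounded_onE[OF bw_continuous_bounded[OF I[OF \<psi>]]] by auto
    have "(\<psi> y - L \<psi>)\<^sup>2 \<le> (N * K + \<bar>L \<psi>\<bar>)\<^sup>2" if "y \<in> ?D" for y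
    proof -
      have "\<bar>\<psi> y\<bar> \<le> N * norm y" using N(2) that by auto
      also have "\<dots> \<le> N * K" using that N(1) by (auto intro: mult_left_mono)
      finally have "\<bar>\<psi> y - L \<psi>\<bar> \<le> N * K + \<bar>L \<psi>\<bar>" by linarith
      then show ?thesis by (rule abs_le_square_iff[THEN iffD1, OF order_trans]) simp
    qed
    then show ?thesis by blast
  qed
  then obtain B where B: "\<And>\<psi> y. \<psi> \<in> I \<Longrightarrow> y \<in> ?D \<Longrightarrow> (\<psi> y - L \<psi>)\<^sup>2 \<le> B \<psi>" by metis
  have "\<exists>y\<in>?D. (\<Sum>\<psi>\<in>I. (\<psi> y - L \<psi>)\<^sup>2) < \<delta>\<^sup>2"
  proof (rule near_zero_of_no_separation)
    have "?D = Y \<inter> cball 0 K" by auto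
    then show "convex ?D" using convex_Y by (simp add: convex_Int)
    show "?D \<noteq> {}" using zero_mem \<open>0 < K\<close> by auto
    show "\<psi> ((1 - t) *\<^sub>R u + t *\<^sub>R v) - L \<psi> = (1 - t) * (\<psi> u - L \<psi>) + t * (\<psi> v - L \<psi>)"
      if "\<psi> \<in> I" "u \<in> ?D" "v \<in> ?D" for \<psi> u v t
    proof -
      have "\<psi> ((1 - t) *\<^sub>R u + t *\<^sub>R v) = (1 - t) * \<psi> u + t * \<psi> v"
        using bw_continuous_linear[OF I] that by (simp add: linear_on_def scaleR_mem)
      then show ?thesis by (simp add: algebra_simps)
    qed
    show "(\<Sum>\<psi>\<in>I. (\<psi> y - L \<psi>)\<^sup>2) \<le> (\<Sum>\<psi>\<in>I. B \<psi>)" if "y \<in> ?D" for y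
      using that by (intro sum_mono B)
    show "b \<le> 0" if b: "\<And>y. y \<in> ?D \<Longrightarrow> b \<le> (\<Sum>\<psi>\<in>I. c \<psi> * (\<psi> y - L \<psi>))" for c b
    proof -
      define \<theta> where "\<theta> = (\<lambda>y. \<Sum>\<psi>\<in>I. c \<psi> * \<psi> y)"
      have \<theta>: "bw_continuous \<theta>"
        unfolding \<theta>_def using \<open>finite I\<close> I by (intro bw_continuous_sum bw_continuous_scaleR)
      have "L (\<lambda>y. \<Sum>\<psi>\<in>I'. c \<psi> * \<psi> y) = (\<Sum>\<psi>\<in>I'. c \<psi> * L \<psi>)" if "I' \<subseteq> I" for I'
        using finite_subset[OF that \<open>finite I\<close>] that
      proof (induction I' rule: finite_induct)
        case (insert \<psi> I')
        then have "bw_continuous (\<lambda>y. \<Sum>\<psi>\<in>I'. c \<psi> * \<psi> y)" "bw_continuous \<psi>"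
          using I by (auto intro!: bw_continuous_sum bw_continuous_scaleR)
        with insert show ?case by (simp add: L_add L_scale bw_continuous_scaleR)
      qed (simp add: L0)
      then have L\<theta>: "L \<theta> = (\<Sum>\<psi>\<in>I. c \<psi> * L \<psi>)" by (simp add: \<theta>_def)
      have low: "b + L \<theta> \<le> \<theta> y" if "y \<in> ?D" for y
        unfolding L\<theta> using b[OF that] by (simp add: \<theta>_def right_diff_distrib sum_subtractf)
      have lin: "\<theta> (r *\<^sub>R y) = r * \<theta> y" if "y \<in> Y" for r y
        using bw_continuous_linear[OF \<theta>] that by (simp add: linear_on_def)
      have abs: "\<bar>\<theta> y\<bar> \<le> - (b + L \<theta>)" if "y \<in> ?D" for y
        using low[of y] low[of "(-1) *\<^sub>R y"] lin[of y "-1"] scaleR_mem[of y "-1"] that by auto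
      have "\<bar>\<theta> y\<bar> \<le> (- (b + L \<theta>) / K) * norm y" if y: "y \<in> Y" for y
      proof (cases "y = 0")
        case True
        then show ?thesis using lin[OF y, of 0] by simp
      next
        case False
        have "\<bar>\<theta> ((K / norm y) *\<^sub>R y)\<bar> \<le> - (b + L \<theta>)"
          using False y \<open>0 < K\<close> by (intro abs) (auto simp: scaleR_mem)
        then show ?thesis
          using False \<open>0 < K\<close> lin[OF y] by (simp add: abs_mult field_simps)
      qed
      then have "\<bar>L \<theta>\<bar> \<le> K * (- (b + L \<theta>) / K)" 
        using abs[of 0] zero_mem \<open>0 < K\<close> by (intro L_bound[OF \<theta>]) auto
      then have "\<bar>L \<theta>\<bar> \<le> - (b + L \<theta>)" using \<open>0 < K\<close> by simp
      then show "b \<le> 0" by linarith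
    qed
  qed (use \<open>0 < \<delta>\<close> in auto)
  then obtain y where y: "y \<in> ?D" "(\<Sum>\<psi>\<in>I. (\<psi> y - L \<psi>)\<^sup>2) < \<delta>\<^sup>2" by auto
  have "\<bar>\<psi> y - L \<psi>\<bar> < \<delta>" if "\<psi> \<in> I" for \<psi>
  proof -
    have "(\<psi> y - L \<psi>)\<^sup>2 \<le> (\<Sum>\<psi>\<in>I. (\<psi> y - L \<psi>)\<^sup>2)"
      using that \<open>finite I\<close> by (intro member_le_sum) auto
    then have "\<bar>\<psi> y - L \<psi>\<bar>\<^sup>2 < \<delta>\<^sup>2" using y by simp
    then show ?thesis using \<open>0 < \<delta>\<close> by (rule power_less_imp_less_base[OF _ less_imp_le])
  qed
  with y show thesis by (intro that) auto
qed

text \<open>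
  A bounded functional on the space of \<open>bw_continuous\<close> functionals is the evaluation at a point of \<open>Y\<close>.
  Its values on the coordinates of evaluations define an element of the dual of the predual, hence
  a point \<open>y\<close> of \<open>Y\<close>. To see that \<open>y\<close> represents \<open>L\<close> at every \<open>\<psi>\<close>, approximate the
  values of \<open>L\<close> at \<open>\<psi>\<close> and at the finitely many evaluations controlling \<open>\<psi>\<close> by a bounded
  point \<open>u\<close>; then \<open>u - y\<close> is small for these evaluations, and so is \<open>\<psi> (u - y)\<close>.

  Every generalized limit in \<open>Y\<close> needed later, whether a mean or a limit along a filter, comes from
  this lemma, and it then automatically commutes with operators that are weak* continuous on the
  ball.
\<close>

lemma bw_dual_evaluation:
  assumes L_add: "\<And>\<psi> \<theta>. bw_continuous \<psi> \<Longrightarrow> bw_continuous \<theta> \<Longrightarrow> L (\<lambda>y. \<psi> y + \<theta> y) = L \<psi> + L \<theta>"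
    and L_scale: "\<And>\<psi> r. bw_continuous \<psi> \<Longrightarrow> L (\<lambda>y. r * \<psi> y) = r * L \<psi>"
    and L_bound: "\<And>\<psi> B. bw_continuous \<psi> \<Longrightarrow> 0 \<le> B \<Longrightarrow> (\<And>y. y \<in> Y \<Longrightarrow> \<bar>\<psi> y\<bar> \<le> B * norm y) \<Longrightarrow> \<bar>L \<psi>\<bar> \<le> K * B"
    and L_cong: "\<And>\<psi> \<theta>. bw_continuous \<psi> \<Longrightarrow> bw_continuous \<theta> \<Longrightarrow> (\<And>y. y \<in> Y \<Longrightarrow> \<psi> y = \<theta> y) \<Longrightarrow> L \<psi> = L \<theta>"
    and "0 \<le> K"
  obtains y where "y \<in> Y" "norm y \<le> K" "\<And>\<psi>. bw_continuous \<psi> \<Longrightarrow> L \<psi> = \<psi> y"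
proof -
  define e where "e = (\<lambda>z b (y::'x). J y z \<bullet> b)"
  have e: "bw_continuous (e z b)" for z b by (simp add: e_def bw_continuous_J)
  define v where "v = (\<lambda>z. \<Sum>b\<in>Basis. L (e z b) *\<^sub>R b)"
  have v_inner: "v z \<bullet> c = L (e z c)" for z c
  proof -
    define h where "h = (\<lambda>c. L (e z c))"
    have h: "linear h"
      unfolding h_def
    proof (rule linearI)
      show "L (e z (b1 + b2)) = L (e z b1) + L (e z b2)" for b1 b2
        using L_add[OF e[of z b1] e[of z b2]] by (simp add: e_def inner_add_right)
      show "L (e z (r *\<^sub>R b)) = r *\<^sub>R L (e z b)" for r b
        using L_scale[OF e[of z b], of r] by (simp add: e_def)
    qed
    have "h c = h (\<Sum>b\<in>Basis. (c \<bullet> b) *\<^sub>R b)" by (simp add: euclidean_representation)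
    also have "\<dots> = (\<Sum>b\<in>Basis. (c \<bullet> b) *\<^sub>R h b)"
      by (simp add: linear_sum[OF h] linear_cmul[OF h])
    finally show ?thesis
      unfolding v_def inner_sum_left by (simp add: h_def inner_commute mult.commute)
  qed
  have norm_v: "norm (v z) \<le> norm z * K" for z
  proof -
    have "\<bar>e z (v z) y\<bar> \<le> (norm z * norm (v z)) * norm y" if y: "y \<in> Y" for y
    proof -
      have "\<bar>e z (v z) y\<bar> \<le> norm (J y z) * norm (v z)"
        unfolding e_def by (rule Cauchy_Schwarz_ineq2)
      also have "\<dots> \<le> (norm y * norm z) * norm (v z)"
        by (intro mult_right_mono norm_J_le y) auto
      finally show ?thesis by (simp add: ac_simps)
    qed
    then have "\<bar>L (e z (v z))\<bar> \<le> K * (norm z * norm (v z))" 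
      by (intro L_bound[OF e]) auto
    then have "norm (v z) * norm (v z) \<le> (norm z * K) * norm (v z)"
      by (simp flip: v_inner add: dot_square_norm power2_eq_square ac_simps)
    then show ?thesis using \<open>0 \<le> K\<close> by (cases "v z = 0") auto
  qed
  have v_add: "v (z1 + z2) = v z1 + v z2" for z1 z2
  proof (rule euclidean_eqI)
    fix b show "v (z1 + z2) \<bullet> b = (v z1 + v z2) \<bullet> b"
      using L_add[OF e[of z1 b] e[of z2 b]]
      by (simp add: v_inner inner_add_left e_def blinfun.add_right)
  qed
  have v_scale: "v (scaleZ a z) = a * v z" for a z
  proof (rule euclidean_eqI)
    fix b
    have lin: "linear ((*) a)" by (simp add: linear_iff algebra_simps)
    have "L (e (scaleZ a z) b) = L (e z (adjoint ((*) a) b))"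
      by (rule L_cong[OF e e]) (simp add: e_def J_arg_scale adjoint_works[OF lin])
    then show "v (scaleZ a z) \<bullet> b = (a * v z) \<bullet> b"
      by (simp add: v_inner adjoint_works[OF lin, symmetric])
  qed
  have "bounded_linear v"
  proof (rule bounded_linear_intro[OF v_add _ norm_v])
    show "v (r *\<^sub>R z) = r *\<^sub>R v z" for r z
      using v_scale[of "of_real r" z] by (simp add: Z.scale_of_real scaleR_conv_of_real)
  qed
  then have app: "blinfun_apply (Blinfun v) = v" by (rule bounded_linear_Blinfun_apply)
  obtain y where y: "y \<in> Y" "J y = Blinfun v"
    by (rule J_surj[of "Blinfun v"]) (auto simp: app linear_on_def v_add v_scale)
  have norm_y: "norm y \<le> K"
    using norm_blinfun_bound[of K "Blinfun v"] norm_v \<open>0 \<le> K\<close> norm_J[OF y(1)]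
    by (simp add: app y(2) mult.commute)
  have ey: "e z b y = L (e z b)" for z b
    by (simp add: e_def y app v_inner)
  show thesis
  proof (rule that[OF y(1) norm_y])
    fix \<psi> assume \<psi>: "bw_continuous \<psi>"
    have "\<bar>L \<psi> - \<psi> y\<bar> \<le> \<epsilon>" if "0 < \<epsilon>" for \<epsilon> :: real
    proof -
      define \<epsilon>' where "\<epsilon>' = \<epsilon> / (4 * (K + 1))"
      have e': "0 < \<epsilon>'" using that \<open>0 \<le> K\<close> by (simp add: \<epsilon>'_def)
      obtain F C where F: "finite F" "0 \<le> C"
          "\<And>u. u \<in> Y \<Longrightarrow> \<bar>\<psi> u\<bar> \<le> \<epsilon>' * norm u + C * (\<Sum>z\<in>F. norm (J u z))"
        using bw_continuousE[OF \<psi> e'] by metis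
      define I where "I = insert \<psi> ((\<lambda>(z, b). e z b) ` (F \<times> Basis))"
      define n where "n = real (card F) * real DIM('k)"
      define \<delta> where "\<delta> = (\<epsilon> / 4) / (C * n + 1)"
      have n: "0 \<le> n" by (simp add: n_def)
      have d: "0 < \<delta>" using that F n by (simp add: \<delta>_def add_nonneg_pos)
      have d': "C * (n * \<delta>) + \<delta> = \<epsilon> / 4"
      proof -
        have "C * n + 1 > 0" using F n by (simp add: add_nonneg_pos)
        then have "(C * n + 1) * \<delta> = \<epsilon> / 4"
          unfolding \<delta>_def by (subst times_divide_eq_right, intro nonzero_mult_div_cancel_left) simp
        then show ?thesis by (simp add: algebra_simps)
      qed
      have bound': "\<bar>L \<theta>\<bar> \<le> (K + 1) * B"
        if "bw_continuous \<theta>" "0 \<le> B" "\<And>y. y \<in> Y \<Longrightarrow> \<bar>\<theta> y\<bar> \<le> B * norm y" for \<theta> B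
        using L_bound[OF that] that(2) by (simp add: distrib_right)
      have I: "finite I" "\<And>\<theta>. \<theta> \<in> I \<Longrightarrow> bw_continuous \<theta>"
        using F e \<psi> by (auto simp: I_def)
      \<comment> \<open>The radius is \<open>K + 1\<close> because the approximation needs a positive one.\<close>
      have "0 < K + 1" using \<open>0 \<le> K\<close> by simp
      from bw_functional_approximation[of L "K + 1" I \<delta>, OF L_add L_scale bound' this I d]
      obtain u where u: "u \<in> Y" "norm u \<le> K + 1" "\<And>\<theta>. \<theta> \<in> I \<Longrightarrow> \<bar>\<theta> u - L \<theta>\<bar> < \<delta>"
        by blast
      have "norm (J (u - y) z) \<le> real DIM('k) * \<delta>" if z: "z \<in> F" for z
      proof -
        have "\<bar>J (u - y) z \<bullet> b\<bar> \<le> \<delta>" if "b \<in> Basis" for b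
        proof -
          have "\<bar>e z b u - L (e z b)\<bar> < \<delta>" using z that by (intro u(3)) (auto simp: I_def)
          then show ?thesis
            by (simp flip: ey) (simp add: e_def J_diff u y(1) inner_diff_left)
        qed
        then have "(\<Sum>b\<in>Basis. \<bar>J (u - y) z \<bullet> b\<bar>) \<le> (\<Sum>b\<in>(Basis::'k set). \<delta>)"
          by (intro sum_mono)
        then show ?thesis using norm_le_l1[of "J (u - y) z"] by simp
      qed
      then have "(\<Sum>z\<in>F. norm (J (u - y) z)) \<le> (\<Sum>z\<in>F. real DIM('k) * \<delta>)" by (intro sum_mono)
      then have "(\<Sum>z\<in>F. norm (J (u - y) z)) \<le> n * \<delta>" by (simp add: n_def mult.assoc)
      then have "C * (\<Sum>z\<in>F. norm (J (u - y) z)) \<le> C * (n * \<delta>)"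
        using F by (intro mult_left_mono) auto
      moreover have "\<epsilon>' * norm (u - y) \<le> \<epsilon> / 2"
      proof -
        have "norm (u - y) \<le> 2 * (K + 1)"
          using order_trans[OF norm_triangle_ineq4 add_mono[OF u(2) norm_y]] by simp
        then have "\<epsilon>' * norm (u - y) \<le> \<epsilon>' * (2 * (K + 1))"
          using e' by (intro mult_left_mono) auto
        also have "\<dots> = \<epsilon> / 2" using \<open>0 \<le> K\<close> by (simp add: \<epsilon>'_def divide_simps)
        finally show ?thesis .
      qed
      moreover have "\<psi> u - \<psi> y = \<psi> (u - y)"
        using bw_continuous_linear[OF \<psi>] diff_mem[OF u(1) y(1)] y(1)
        unfolding linear_on_def by (metis add_diff_cancel_right' diff_add_cancel)
      moreover have "\<bar>\<psi> u - L \<psi>\<bar> < \<delta>" by (rule u(3)) (simp add: I_def)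
      ultimately show ?thesis
        using F(3)[OF diff_mem[OF u(1) y(1)]] d' d \<open>0 < \<epsilon>\<close> by linarith
    qed
    then have "\<bar>L \<psi> - \<psi> y\<bar> \<le> 0" by (rule field_le_epsilon[of _ 0, simplified])
    then show "L \<psi> = \<psi> y" by simp
  qed
qed

text \<open>
  The preceding lemma applied at every \<open>x\<close>; the resulting points depend linearly on \<open>x\<close> because the
  functionals separate the points of \<open>Y\<close>.
\<close>

lemma bw_operator:
  assumes L_add: "\<And>x \<psi> \<theta>. bw_continuous \<psi> \<Longrightarrow> bw_continuous \<theta> \<Longrightarrow> L x (\<lambda>y. \<psi> y + \<theta> y) = L x \<psi> + L x \<theta>"
    and L_scale: "\<And>x \<psi> r. bw_continuous \<psi> \<Longrightarrow> L x (\<lambda>y. r * \<psi> y) = r * L x \<psi>"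
    and L_bound: "\<And>x \<psi> B. bw_continuous \<psi> \<Longrightarrow> 0 \<le> B \<Longrightarrow> (\<And>y. y \<in> Y \<Longrightarrow> \<bar>\<psi> y\<bar> \<le> B * norm y) \<Longrightarrow>
      \<bar>L x \<psi>\<bar> \<le> K * norm x * B"
    and L_cong: "\<And>x \<psi> \<theta>. bw_continuous \<psi> \<Longrightarrow> bw_continuous \<theta> \<Longrightarrow> (\<And>y. y \<in> Y \<Longrightarrow> \<psi> y = \<theta> y) \<Longrightarrow>
      L x \<psi> = L x \<theta>"
    and L_arg_add: "\<And>x x' \<psi>. bw_continuous \<psi> \<Longrightarrow> L (x + x') \<psi> = L x \<psi> + L x' \<psi>"
    and L_arg_scale: "\<And>x a \<psi>. bw_continuous \<psi> \<Longrightarrow> L (scaleX a x) \<psi> = L x (\<lambda>y. \<psi> (scaleX a y))"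
    and "0 \<le> K"
  obtains Q where "Q \<in> operators scaleX" "range (blinfun_apply Q) \<subseteq> Y" "norm Q \<le> K"
    "\<And>x \<psi>. bw_continuous \<psi> \<Longrightarrow> \<psi> (Q x) = L x \<psi>"
proof -
  have "\<exists>y. y \<in> Y \<and> norm y \<le> K * norm x \<and> (\<forall>\<psi>. bw_continuous \<psi> \<longrightarrow> L x \<psi> = \<psi> y)" for x
  proof -
    have "0 \<le> K * norm x" using \<open>0 \<le> K\<close> by simp
    then obtain y where "y \<in> Y" "norm y \<le> K * norm x" "\<And>\<psi>. bw_continuous \<psi> \<Longrightarrow> L x \<psi> = \<psi> y"
      using bw_dual_evaluation[of "L x" "K * norm x", OF L_add L_scale L_bound L_cong]
      by blast
    then show ?thesis by blast
  qed
  then obtain q where q: "\<And>x. q x \<in> Y" "\<And>x. norm (q x) \<le> K * norm x"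
      "\<And>x \<psi>. bw_continuous \<psi> \<Longrightarrow> L x \<psi> = \<psi> (q x)"
    by metis
  have q_add: "q (x + x') = q x + q x'" for x x'
  proof (rule eq_if_bw_equal)
    fix \<psi> assume "bw_continuous \<psi>"
    then show "\<psi> (q (x + x')) = \<psi> (q x + q x')"
      using bw_continuous_linear[of \<psi>] L_arg_add[of \<psi> x x'] q(1) by (simp add: q(3) linear_on_def)
  qed (auto simp: q add_mem)
  have q_scale: "q (scaleX a x) = scaleX a (q x)" for a x
  proof (rule eq_if_bw_equal)
    fix \<psi> assume "bw_continuous \<psi>"
    then show "\<psi> (q (scaleX a x)) = \<psi> (scaleX a (q x))"
      using L_arg_scale[of \<psi> a x] q(3)[OF bw_continuous_scale, of \<psi> x a] by (simp add: q(3))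
  qed (auto simp: q scale_mem)
  have "bounded_linear q"
  proof (rule bounded_linear_intro[OF q_add])
    show "q (r *\<^sub>R x) = r *\<^sub>R q x" for r x
      using q_scale[of "of_real r" x] by (simp add: X.scale_of_real)
    show "norm (q x) \<le> norm x * K" for x using q(2)[of x] by (simp add: mult.commute)
  qed
  then have app: "blinfun_apply (Blinfun q) = q" by (rule bounded_linear_Blinfun_apply)
  show thesis
  proof (rule that[of "Blinfun q"])
    show "Blinfun q \<in> operators scaleX" by (simp add: operators_def linear_on_def app q_add q_scale)
    show "range (blinfun_apply (Blinfun q)) \<subseteq> Y" using q(1) by (auto simp: app)
    show "norm (Blinfun q) \<le> K" using \<open>0 \<le> K\<close> q(2) by (intro norm_blinfun_bound) (auto simp: app)
    show "\<psi> (Blinfun q x) = L x \<psi>" if "bw_continuous \<psi>" for x \<psi> using q(3)[OF that] by (simp add: app)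
  qed
qed

end


section \<open>The action and the inverses on the subspace\<close>

locale dual_subspace_action = dual_subspace scaleX scaleZ Y J
  for scaleX :: "'k::{real_normed_field,euclidean_space} \<Rightarrow> 'x::banach \<Rightarrow> 'x"
    and scaleZ :: "'k \<Rightarrow> 'z::banach \<Rightarrow> 'z" and Y :: "'x set" and J :: "'x \<Rightarrow> ('z \<Rightarrow>\<^sub>L 'k)" +
  fixes T :: "'s::{semigroup_mult,topological_space} \<Rightarrow> ('x \<Rightarrow>\<^sub>L 'x)"
  assumes T_operators: "T s \<in> operators scaleX"
    and T_hom: "T (s * t) = T s o\<^sub>L T t"
    and T_continuous: "continuous_on UNIV (\<lambda>s. T s x)"
    and T_isomorphism: "isomorphism_on scaleX Y (T s)"
    and T_weak_star: "continuous_map (subtopology (weak_star_topology Y J) {y\<in>Y. norm y \<le> 1})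
      (weak_star_topology Y J) (T s)"
    and distortion_bounded: "bdd_above (range (distortion Y T))"
begin

abbreviation M :: real where "M \<equiv> m_const Y T"

definition R :: "'s \<Rightarrow> 'x \<Rightarrow> 'x" where
  "R s = inv_into Y (T s)"

lemma T_scale: "T s (scaleX a x) = scaleX a (T s x)"
  using T_operators[of s] by (simp add: operators_def linear_on_def)

lemma T_bij: "bij_betw (T s) Y Y"
  using T_isomorphism[of s] by (simp add: isomorphism_on_def)

lemma T_mem: "y \<in> Y \<Longrightarrow> T s y \<in> Y"
  using T_bij by (rule bij_betwE[rule_format])

lemma R_mem: "y \<in> Y \<Longrightarrow> R s y \<in> Y"
  and T_R: "y \<in> Y \<Longrightarrow> T s (R s y) = y"
  and R_T: "y \<in> Y \<Longrightarrow> R s (T s y) = y"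
  using T_bij[of s]
  by (auto simp: R_def bij_betw_def inv_into_into f_inv_into_f)

lemma R_add: "u \<in> Y \<Longrightarrow> v \<in> Y \<Longrightarrow> R s (u + v) = R s u + R s v"
  using R_T[of "R s u + R s v" s] by (simp add: blinfun.add_right T_R R_mem add_mem)

lemma R_scale: "u \<in> Y \<Longrightarrow> R s (scaleX a u) = scaleX a (R s u)"
  using R_T[of "scaleX a (R s u)" s] by (simp add: T_scale T_R R_mem scale_mem)

lemma R_scaleR: "u \<in> Y \<Longrightarrow> R s (r *\<^sub>R u) = r *\<^sub>R R s u"
  using R_scale[of u s "of_real r"] by (simp add: X.scale_of_real)

lemma R_hom: "y \<in> Y \<Longrightarrow> R (s * t) y = R t (R s y)"
  using R_T[of "R t (R s y)" "s * t"] by (simp add: T_hom T_R R_mem)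

lemma R_bounded: "bounded_on Y (R s)"
  using T_isomorphism[of s] by (simp add: isomorphism_on_def R_def)

lemma norm_R_le_onorm:
  assumes "y \<in> Y" "norm y \<le> 1"
  shows "norm (R s y) \<le> onorm_on Y (R s)"
proof -
  obtain C where C: "0 \<le> C" "\<And>y. y \<in> Y \<Longrightarrow> norm (R s y) \<le> C * norm y"
    using bounded_onE[OF R_bounded] by blast
  have "norm (R s y) \<le> C" if "y \<in> Y" "norm y \<le> 1" for y
    using C(2)[OF that(1)] mult_left_mono[OF that(2) C(1)] by simp
  then have "bdd_above ((\<lambda>y. norm (R s y)) ` {y \<in> Y. norm y \<le> 1})"
    by (auto simp: bdd_above_def)
  then show ?thesis
    unfolding onorm_on_def using assms by (intro cSUP_upper) auto
qed

lemma norm_R_le: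
  assumes "y \<in> Y"
  shows "norm (R s y) \<le> onorm_on Y (R s) * norm y"
proof (cases "y = 0")
  case True
  then show ?thesis using R_T[OF zero_mem, of s] by simp
next
  case False
  have "norm (R s ((1 / norm y) *\<^sub>R y)) \<le> onorm_on Y (R s)"
    using assms by (intro norm_R_le_onorm) (auto simp: scaleR_mem)
  then show ?thesis using False assms by (simp add: R_scaleR divide_simps)
qed

lemma distortion_le: "distortion Y T s \<le> M"
  unfolding m_const_def using distortion_bounded by (intro cSUP_upper) auto

text \<open>
  This is how the finiteness of the constant enters: the product of the norms of \<open>T s\<close> and of its
  inverse on \<open>Y\<close> is bounded uniformly in \<open>s\<close>, although neither factor has to be.
\<close>

lemma norm_T_R: "y \<in> Y \<Longrightarrow> norm (T s) * norm (R s y) \<le> M * norm y"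
proof -
  assume y: "y \<in> Y"
  have "norm (T s) * norm (R s y) \<le> norm (T s) * (onorm_on Y (R s) * norm y)"
    by (intro mult_left_mono norm_R_le y) auto
  also have "\<dots> = distortion Y T s * norm y" by (simp add: distortion_def R_def)
  also have "\<dots> \<le> M * norm y" by (intro mult_right_mono distortion_le) auto
  finally show ?thesis .
qed

lemma M_nonneg: "0 \<le> M"
proof -
  fix s :: 's
  have "0 \<le> onorm_on Y (R s)"
    by (rule order_trans[OF norm_ge_zero norm_R_le_onorm[OF zero_mem]]) simp
  then have "0 \<le> distortion Y T s" by (simp add: distortion_def R_def)
  with distortion_le show ?thesis by (rule order_trans[rotated])
qed

text \<open>
  A nonzero \<open>v\<close> in \<open>Y\<close> has a nonzero image \<open>T s0 v\<close>, so the norm of \<open>T s\<close> stays away from \<open>0\<close>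
  for \<open>s\<close> near \<open>s0\<close>, and the bound on the product turns this into an upper bound for the inverses.
\<close>

lemma R_locally_bounded:
  obtains B where "0 \<le> B" "eventually (\<lambda>s. \<forall>y\<in>Y. norm (R s y) \<le> B * norm y) (at s0)"
proof (cases "Y \<subseteq> {0}")
  case True
  then have "R s y = 0" if "y \<in> Y" for s y using R_mem[OF that, of s] by auto
  then show thesis by (intro that[of 0]) auto
next
  case False
  then obtain v where v: "v \<in> Y" "v \<noteq> 0" by auto
  define c where "c = norm (T s0 v) / 2"
  have "T s0 v \<noteq> 0" using R_T[OF v(1), of s0] R_T[OF zero_mem, of s0] v(2) by auto
  then have c: "0 < c" by (simp add: c_def)
  have "((\<lambda>s. norm (T s v)) \<longlongrightarrow> norm (T s0 v)) (at s0)"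
    using T_continuous[of v] by (intro tendsto_norm) (simp add: continuous_on_def)
  moreover have "c < norm (T s0 v)" using c by (simp add: c_def)
  ultimately have ev: "eventually (\<lambda>s. c < norm (T s v)) (at s0)" by (rule order_tendstoD)
  define B where "B = M * norm v / c"
  show thesis
  proof (rule that)
    show "0 \<le> B" using c M_nonneg by (simp add: B_def)
    show "eventually (\<lambda>s. \<forall>y\<in>Y. norm (R s y) \<le> B * norm y) (at s0)"
      using ev
    proof (rule eventually_mono, intro ballI)
      fix s y assume s: "c < norm (T s v)" and y: "y \<in> Y"
      have "c * norm (R s y) \<le> (norm (T s) * norm v) * norm (R s y)"
        using s norm_blinfun[of "T s" v] by (intro mult_right_mono) auto
      also have "\<dots> = (norm (T s) * norm (R s y)) * norm v" by simp
      also have "\<dots> \<le> (M * norm y) * norm v" by (intro mult_right_mono norm_T_R y) auto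
      finally show "norm (R s y) \<le> B * norm y" using c by (simp add: B_def field_simps)
    qed
  qed
qed

lemma R_diff: "u \<in> Y \<Longrightarrow> v \<in> Y \<Longrightarrow> R s (u - v) = R s u - R s v"
  using R_add[of "u - v" v s] diff_mem[of u v] by simp

text \<open>
  Continuity of the inverses follows from
  \<open>R s (w s) - R s0 (w s0) = R s (w s - T s (R s0 (w s0)))\<close> and their local boundedness.
\<close>

lemma R_continuous:
  assumes "\<And>s. w s \<in> Y" "continuous_on UNIV w"
  shows "continuous_on UNIV (\<lambda>s. R s (w s))"
  unfolding continuous_on_def
proof (intro ballI)
  fix s0
  obtain B where B: "0 \<le> B" "eventually (\<lambda>s. \<forall>y\<in>Y. norm (R s y) \<le> B * norm y) (at s0)"
    by (rule R_locally_bounded)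
  let ?v = "R s0 (w s0)"
  have "((\<lambda>s. w s - T s ?v) \<longlongrightarrow> w s0 - T s0 ?v) (at s0)"
    using assms(2) T_continuous[of ?v] by (intro tendsto_diff) (auto simp: continuous_on_def)
  then have "((\<lambda>s. w s - T s ?v) \<longlongrightarrow> 0) (at s0)" by (simp add: T_R assms)
  moreover have "eventually (\<lambda>s. norm (R s (w s) - ?v) \<le> norm (w s - T s ?v) * B) (at s0)"
    using B(2)
  proof (rule eventually_mono)
    fix s assume s: "\<forall>y\<in>Y. norm (R s y) \<le> B * norm y"
    have v: "?v \<in> Y" by (simp add: R_mem assms)
    then have "R s (w s - T s ?v) = R s (w s) - ?v"
      by (simp add: R_diff assms T_mem R_T)
    then show "norm (R s (w s) - ?v) \<le> norm (w s - T s ?v) * B"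
      using s diff_mem[OF assms(1)[of s] T_mem[OF v, of s]] by (metis mult.commute)
  qed
  ultimately have "((\<lambda>s. R s (w s) - ?v) \<longlongrightarrow> 0) (at s0)" by (rule tendsto_0_le)
  then show "((\<lambda>s. R s (w s)) \<longlongrightarrow> ?v) (at s0 within UNIV)" by (simp add: LIM_zero_iff)
qed

definition functional :: "('x \<Rightarrow> real) \<Rightarrow> bool" where
  "functional \<psi> \<longleftrightarrow> linear_on scaleR scaleR Y \<psi> \<and> bounded_on Y \<psi>"

lemma bw_functional: "bw_continuous \<psi> \<Longrightarrow> functional \<psi>"
  by (simp add: functional_def bw_continuous_linear bw_continuous_bounded)

lemma functional_diff: "functional \<psi> \<Longrightarrow> u \<in> Y \<Longrightarrow> v \<in> Y \<Longrightarrow> \<psi> (u - v) = \<psi> u - \<psi> v"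
  using diff_mem[of u v] unfolding functional_def linear_on_def
  by (metis add_diff_cancel_right' diff_add_cancel)

lemma functional_R:
  assumes "functional \<psi>"
  shows "functional (\<lambda>y. \<psi> (R s y))"
proof -
  obtain C where C: "0 \<le> C" "\<And>y. y \<in> Y \<Longrightarrow> \<bar>\<psi> y\<bar> \<le> C * norm y"
    using assms bounded_onE[of Y \<psi>] by (auto simp: functional_def)
  obtain D where D: "0 \<le> D" "\<And>y. y \<in> Y \<Longrightarrow> norm (R s y) \<le> D * norm y"
    using bounded_onE[OF R_bounded] by blast
  have "\<bar>\<psi> (R s y)\<bar> \<le> (C * D) * norm y" if y: "y \<in> Y" for y
    using order_trans[OF C(2)[OF R_mem[OF y]] mult_left_mono[OF D(2)[OF y] C(1)]]
    by (simp add: mult.assoc)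
  moreover have "linear_on scaleR scaleR Y (\<lambda>y. \<psi> (R s y))"
    using assms by (auto simp: functional_def linear_on_def R_add R_scaleR R_mem)
  ultimately show ?thesis by (auto simp: functional_def bounded_on_def)
qed

lemma functional_continuous:
  assumes \<psi>: "functional \<psi>" and w: "\<And>s. w s \<in> Y" "continuous_on UNIV w"
  shows "continuous_on UNIV (\<lambda>s. \<psi> (w s))"
  unfolding continuous_on_def
proof (intro ballI)
  fix s0
  obtain C where C: "0 \<le> C" "\<And>y. y \<in> Y \<Longrightarrow> \<bar>\<psi> y\<bar> \<le> C * norm y"
    using \<psi> bounded_onE[of Y \<psi>] by (auto simp: functional_def)
  have "((\<lambda>s. w s - w s0) \<longlongrightarrow> 0) (at s0)"
    using w(2) by (intro LIM_zero) (auto simp: continuous_on_def)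
  moreover have "eventually (\<lambda>s. norm (\<psi> (w s) - \<psi> (w s0)) \<le> norm (w s - w s0) * C) (at s0)"
    using C(2)[OF diff_mem[OF w(1) w(1)]]
    by (intro always_eventually) (simp add: functional_diff[OF \<psi> w(1) w(1)] mult.commute)
  ultimately have "((\<lambda>s. \<psi> (w s) - \<psi> (w s0)) \<longlongrightarrow> 0) (at s0)" by (rule tendsto_0_le)
  then show "((\<lambda>s. \<psi> (w s)) \<longlongrightarrow> \<psi> (w s0)) (at s0 within UNIV)" by (simp add: LIM_zero_iff)
qed

lemma bw_continuous_T:
  assumes "bw_continuous \<psi>"
  shows "bw_continuous (\<lambda>y. \<psi> (T s y))"
proof (rule bw_continuous_compose[OF _ _ _ _ assms])
  show lin: "linear_on scaleR scaleR Y (T s)"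
    by (simp add: linear_on_def blinfun.add_right blinfun.scaleR_right)
  show bdd: "bounded_on Y (T s)"
    unfolding bounded_on_def using norm_blinfun by blast
  show "bw_continuous (\<lambda>y. J (T s y) z \<bullet> b)" for z b
    by (rule bw_continuous_J_compose[OF _ lin bdd T_weak_star]) (rule T_mem)
qed (rule T_mem)

end


section \<open>Averaging a projection\<close>

locale projection_action = dual_subspace_action scaleX scaleZ Y J T
  for scaleX :: "'k::{real_normed_field,euclidean_space} \<Rightarrow> 'x::banach \<Rightarrow> 'x"
    and scaleZ :: "'k \<Rightarrow> 'z::banach \<Rightarrow> 'z" and Y :: "'x set" and J :: "'x \<Rightarrow> ('z \<Rightarrow>\<^sub>L 'k)"
    and T :: "'s::{semigroup_mult,topological_space} \<Rightarrow> ('x \<Rightarrow>\<^sub>L 'x)" +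
  fixes P :: "'x \<Rightarrow>\<^sub>L 'x"
  assumes projection: "is_projection scaleX Y P"
begin

lemma P_mem: "P x \<in> Y" and P_fix: "y \<in> Y \<Longrightarrow> P y = y" and P_scale: "P (scaleX a x) = scaleX a (P x)"
  using projection by (auto simp: is_projection_def operators_def linear_on_def)

definition conjugate :: "'s \<Rightarrow> 'x \<Rightarrow> 'x" where
  "conjugate s x = R s (P (T s x))"

lemma conjugate_mem: "conjugate s x \<in> Y"
  by (simp add: conjugate_def R_mem P_mem)

lemma conjugate_fix: "y \<in> Y \<Longrightarrow> conjugate s y = y"
  by (simp add: conjugate_def P_fix T_mem R_T)

lemma conjugate_add: "conjugate s (x + x') = conjugate s x + conjugate s x'"
  by (simp add: conjugate_def blinfun.add_right R_add P_mem)

lemma conjugate_diff: "conjugate s (x - x') = conjugate s x - conjugate s x'"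
  by (simp add: conjugate_def blinfun.diff_right R_diff P_mem)

lemma conjugate_scale: "conjugate s (scaleX a x) = scaleX a (conjugate s x)"
  by (simp add: conjugate_def T_scale P_scale R_scale P_mem)

lemma conjugate_mult: "conjugate (s * t) x = R t (conjugate s (T t x))"
  by (simp add: conjugate_def T_hom R_hom P_mem)

text \<open>
  The norms of \<open>T s\<close> and \<open>R s\<close> occur only as a product, so the conjugates of \<open>P\<close> are
  uniformly bounded; this is the source of the constant in the theorem.
\<close>

lemma norm_conjugate_le: "norm (conjugate s x) \<le> M * norm P * norm x"
proof (cases "norm (T s) = 0")
  case True
  have "R s 0 = 0" using R_T[OF zero_mem, of s] by simp
  with True show ?thesis using M_nonneg by (simp add: conjugate_def)
next
  case False
  then have pos: "0 < norm (T s)" by simp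
  have "norm (T s) * norm (conjugate s x) \<le> M * norm (P (T s x))"
    unfolding conjugate_def by (intro norm_T_R P_mem)
  also have "\<dots> \<le> M * (norm P * (norm (T s) * norm x))"
    by (intro mult_left_mono order_trans[OF norm_blinfun] norm_blinfun M_nonneg) auto
  also have "\<dots> = norm (T s) * (M * norm P * norm x)" by simp
  finally show ?thesis using pos by simp
qed

lemma conjugate_continuous: "continuous_on UNIV (\<lambda>s. conjugate s x)"
  unfolding conjugate_def
  by (intro R_continuous P_mem bounded_linear.continuous_on[OF blinfun.bounded_linear_right] T_continuous)

text \<open>
  The bounded function on the semigroup whose mean defines the averaged projection, tested against
  \<open>\<psi>\<close>. The construction \<open>Bcontfun\<close> is meaningful when \<open>\<psi>\<close> is linear and bounded on \<open>Y\<close>.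
\<close>

definition orbit :: "'x \<Rightarrow> ('x \<Rightarrow> real) \<Rightarrow> ('s \<Rightarrow>\<^sub>C real)" where
  "orbit x \<psi> = Bcontfun (\<lambda>s. \<psi> (conjugate s x))"

lemma orbit_cong: "(\<And>y. y \<in> Y \<Longrightarrow> \<psi> y = \<theta> y) \<Longrightarrow> orbit x \<psi> = orbit x \<theta>"
  by (simp add: orbit_def conjugate_mem)

lemma functional_conjugate_le:
  assumes "\<And>y. y \<in> Y \<Longrightarrow> \<bar>\<psi> y\<bar> \<le> B * norm y" "0 \<le> B"
  shows "\<bar>\<psi> (conjugate s x)\<bar> \<le> M * norm P * norm x * B"
  using assms(1)[OF conjugate_mem, of s x] mult_right_mono[OF norm_conjugate_le \<open>0 \<le> B\<close>, of s x]
  by (simp add: mult.commute)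

lemma orbit_apply:
  assumes "functional \<psi>"
  shows "orbit x \<psi> s = \<psi> (conjugate s x)"
proof -
  obtain C where C: "0 \<le> C" "\<And>y. y \<in> Y \<Longrightarrow> \<bar>\<psi> y\<bar> \<le> C * norm y"
    using assms bounded_onE[of Y \<psi>] by (auto simp: functional_def)
  have "(\<lambda>s. \<psi> (conjugate s x)) \<in> bcontfun"
  proof (rule bcontfun_normI)
    show "continuous_on UNIV (\<lambda>s. \<psi> (conjugate s x))"
      by (intro functional_continuous assms conjugate_mem conjugate_continuous)
    show "norm (\<psi> (conjugate s x)) \<le> M * norm P * norm x * C" for s
      using functional_conjugate_le[of \<psi> C s x] C by simp
  qed
  then show ?thesis by (simp add: orbit_def Bcontfun_inverse)
qed

lemma norm_orbit_le:
  assumes "functional \<psi>" "\<And>y. y \<in> Y \<Longrightarrow> \<bar>\<psi> y\<bar> \<le> B * norm y" "0 \<le> B"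
  shows "norm (orbit x \<psi>) \<le> M * norm P * norm x * B"
  by (rule norm_bound) (simp add: orbit_apply assms functional_conjugate_le)

lemma orbit_C_r:
  assumes "functional \<psi>"
  shows "orbit x \<psi> \<in> C_r"
proof -
  have "continuous_on UNIV (\<lambda>s. \<psi> (R t (conjugate s (T t x))))" for t
    using functional_continuous[OF functional_R[OF assms] conjugate_mem conjugate_continuous] .
  then show ?thesis by (simp add: C_r_def orbit_apply[OF assms] conjugate_mult)
qed

lemma right_translate_orbit:
  assumes "functional \<psi>"
  shows "right_translate t (orbit x \<psi>) = orbit (T t x) (\<lambda>y. \<psi> (R t y))"
  by (rule bcontfun_eqI)
    (simp add: apply_right_translate orbit_C_r assms orbit_apply functional_R conjugate_mult)

lemma orbit_add:
  assumes "functional \<psi>" "functional \<theta>" "functional (\<lambda>y. \<psi> y + \<theta> y)"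
  shows "orbit x (\<lambda>y. \<psi> y + \<theta> y) = orbit x \<psi> + orbit x \<theta>"
  by (rule bcontfun_eqI) (simp add: orbit_apply assms)

lemma orbit_scaleR:
  assumes "functional \<psi>" "functional (\<lambda>y. r * \<psi> y)"
  shows "orbit x (\<lambda>y. r * \<psi> y) = r *\<^sub>R orbit x \<psi>"
  by (rule bcontfun_eqI) (simp add: orbit_apply assms)

lemma orbit_arg_add:
  assumes "functional \<psi>"
  shows "orbit (x + x') \<psi> = orbit x \<psi> + orbit x' \<psi>"
  using assms conjugate_mem unfolding functional_def linear_on_def
  by (intro bcontfun_eqI) (simp add: orbit_apply assms conjugate_add)

lemma orbit_arg_scale: "orbit (scaleX a x) \<psi> = orbit x (\<lambda>y. \<psi> (scaleX a y))"
  by (simp add: orbit_def conjugate_scale)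

text \<open>
  Averaging the conjugates of \<open>P\<close> with respect to any bounded functional \<open>\<Lambda>\<close>, not
  necessarily a mean: the proof that orbits lie in \<open>C_weak\<close> has to treat all bounded functionals
  on \<open>C_r\<close>.
\<close>

lemma mean_operator:
  assumes lin: "linear_on scaleR scaleR V \<Lambda>"
    and bound: "\<And>f. f \<in> V \<Longrightarrow> \<bar>\<Lambda> f\<bar> \<le> C * norm f" "0 \<le> C"
    and V: "\<And>x \<psi>. bw_continuous \<psi> \<Longrightarrow> orbit x \<psi> \<in> V"
  obtains Q where "Q \<in> operators scaleX" "range (blinfun_apply Q) \<subseteq> Y" "norm Q \<le> C * M * norm P"
    "\<And>x \<psi>. bw_continuous \<psi> \<Longrightarrow> \<psi> (Q x) = \<Lambda> (orbit x \<psi>)"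
proof (rule bw_operator[of "\<lambda>x \<psi>. \<Lambda> (orbit x \<psi>)" "C * M * norm P"])
  show "\<Lambda> (orbit x (\<lambda>y. \<psi> y + \<theta> y)) = \<Lambda> (orbit x \<psi>) + \<Lambda> (orbit x \<theta>)"
    if "bw_continuous \<psi>" "bw_continuous \<theta>" for x \<psi> \<theta>
    using lin V that by (simp add: orbit_add bw_functional bw_continuous_add linear_on_def)
  show "\<Lambda> (orbit x (\<lambda>y. r * \<psi> y)) = r * \<Lambda> (orbit x \<psi>)" if "bw_continuous \<psi>" for x \<psi> r
    using lin V that by (simp add: orbit_scaleR bw_functional bw_continuous_scaleR linear_on_def)
  show "\<bar>\<Lambda> (orbit x \<psi>)\<bar> \<le> C * M * norm P * norm x * B"
    if "bw_continuous \<psi>" "0 \<le> B" "\<And>y. y \<in> Y \<Longrightarrow> \<bar>\<psi> y\<bar> \<le> B * norm y" for x \<psi> B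
  proof -
    have "\<bar>\<Lambda> (orbit x \<psi>)\<bar> \<le> C * norm (orbit x \<psi>)" using bound V that by simp
    also have "\<dots> \<le> C * (M * norm P * norm x * B)"
      using that by (intro mult_left_mono norm_orbit_le bw_functional bound)
    finally show ?thesis by (simp add: mult.assoc)
  qed
  show "\<Lambda> (orbit x \<psi>) = \<Lambda> (orbit x \<theta>)"
    if "\<And>y. y \<in> Y \<Longrightarrow> \<psi> y = \<theta> y" for x \<psi> \<theta>
    using orbit_cong[of \<psi> \<theta> x] that by simp
  show "\<Lambda> (orbit (x + x') \<psi>) = \<Lambda> (orbit x \<psi>) + \<Lambda> (orbit x' \<psi>)" if "bw_continuous \<psi>" for x x' \<psi>
    using lin V that by (simp add: orbit_arg_add bw_functional linear_on_def)
qed (use bound M_nonneg in \<open>auto simp: orbit_arg_scale intro: that\<close>)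

text \<open>
  With \<open>u\<close> and \<open>v\<close> the conjugates by \<open>t\<close> applied to \<open>T s x\<close> and \<open>T s0 x\<close>, the difference of the
  translates at \<open>t\<close> is \<open>\<psi>\<close> of \<open>R s (u - T s (R s0 v))\<close>. Since
  \<open>u - T s (R s0 v) = (u - v) + (T s0 - T s) (R s0 v)\<close> and conjugates are uniformly bounded in
  \<open>t\<close>, this is small uniformly in \<open>t\<close> once \<open>T s\<close> is close to \<open>T s0\<close> in norm. The second condition
  on members of \<open>C_norm\<close> reduces to the first because a translate of an orbit is again an orbit.
\<close>

lemma orbit_C_norm:
  assumes T: "continuous_on UNIV T" and \<psi>: "functional \<psi>"
  shows "orbit x \<psi> \<in> C_norm"
proof -
  have cont: "continuous_on UNIV (\<lambda>s. right_translate s (orbit x \<psi>))" if \<psi>: "functional \<psi>" for x \<psi>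
    unfolding continuous_on_def
  proof (intro ballI)
    fix s0
    obtain N where N: "0 \<le> N" "\<And>y. y \<in> Y \<Longrightarrow> \<bar>\<psi> y\<bar> \<le> N * norm y"
      using \<psi> bounded_onE[of Y \<psi>] by (auto simp: functional_def)
    obtain B where B: "0 \<le> B" "eventually (\<lambda>s. \<forall>y\<in>Y. norm (R s y) \<le> B * norm y) (at s0)"
      by (rule R_locally_bounded)
    obtain D where D: "0 \<le> D" "\<And>y. y \<in> Y \<Longrightarrow> norm (R s0 y) \<le> D * norm y"
      using bounded_onE[OF R_bounded] by blast
    define A where "A = M * norm P"
    have A: "0 \<le> A" using M_nonneg by (simp add: A_def)
    define h where "h = (\<lambda>s. A * norm (T s x - T s0 x) + norm (T s0 - T s) * (D * (A * norm (T s0 x))))"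
    have "((\<lambda>s. T s) \<longlongrightarrow> T s0) (at s0)" "((\<lambda>s. T s x) \<longlongrightarrow> T s0 x) (at s0)"
      using T T_continuous[of x] by (auto simp: continuous_on_def)
    then have "(h \<longlongrightarrow> A * norm (T s0 x - T s0 x) + norm (T s0 - T s0) * (D * (A * norm (T s0 x)))) (at s0)"
      unfolding h_def by (intro tendsto_intros)
    then have h0: "(h \<longlongrightarrow> 0) (at s0)" by simp
    have "eventually (\<lambda>s. norm (right_translate s (orbit x \<psi>) - right_translate s0 (orbit x \<psi>))
        \<le> norm (h s) * (N * B)) (at s0)"
      using B(2)
    proof (rule eventually_mono)
      fix s assume s: "\<forall>y\<in>Y. norm (R s y) \<le> B * norm y"
      show "norm (right_translate s (orbit x \<psi>) - right_translate s0 (orbit x \<psi>)) \<le> norm (h s) * (N * B)"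
      proof (rule norm_bound)
        fix t
        define u where "u = conjugate t (T s x)"
        define v where "v = conjugate t (T s0 x)"
        have Y: "u \<in> Y" "v \<in> Y" "R s0 v \<in> Y" by (simp_all add: u_def v_def conjugate_mem R_mem)
        then have TY: "T s (R s0 v) \<in> Y" by (simp add: T_mem)
        have eq: "R s u - R s0 v = R s (u - T s (R s0 v))"
          using Y TY by (simp add: R_diff R_T)
        have "u - T s (R s0 v) = conjugate t (T s x - T s0 x) + (T s0 - T s) (R s0 v)"
          using Y by (simp add: u_def conjugate_diff blinfun.diff_left T_R) (simp add: v_def)
        also have "norm \<dots> \<le> A * norm (T s x - T s0 x) + norm (T s0 - T s) * norm (R s0 v)"
          unfolding A_def by (intro norm_triangle_mono norm_conjugate_le norm_blinfun)
        also have "\<dots> \<le> h s"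
        proof -
          have "norm (R s0 v) \<le> D * norm v" by (rule D(2)[OF Y(2)])
          also have "\<dots> \<le> D * (A * norm (T s0 x))"
            unfolding v_def A_def by (intro mult_left_mono norm_conjugate_le D)
          finally show ?thesis unfolding h_def by (intro add_left_mono mult_left_mono) auto
        qed
        finally have le: "norm (u - T s (R s0 v)) \<le> norm (h s)" by simp
        have "apply_bcontfun (right_translate s (orbit x \<psi>) - right_translate s0 (orbit x \<psi>)) t
            = \<psi> (R s u) - \<psi> (R s0 v)"
          using \<psi> by (simp add: right_translate_orbit orbit_apply functional_R u_def v_def)
        also have "\<dots> = \<psi> (R s (u - T s (R s0 v)))"
          using Y by (simp add: functional_diff[OF \<psi>, symmetric] R_mem eq)
        finally have "norm (apply_bcontfun (right_translate s (orbit x \<psi>) - right_translate s0 (orbit x \<psi>)) t)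
            \<le> N * norm (R s (u - T s (R s0 v)))"
          using N(2)[OF R_mem[OF diff_mem[OF Y(1) TY]]] by simp
        also have "\<dots> \<le> N * (B * norm (h s))"
          using s diff_mem[OF Y(1) TY] le N B
          by (intro mult_left_mono) (auto intro: order_trans mult_left_mono)
        finally show "norm (apply_bcontfun (right_translate s (orbit x \<psi>) - right_translate s0 (orbit x \<psi>)) t)
            \<le> norm (h s) * (N * B)" by (simp add: ac_simps)
      qed
    qed
    with h0 have "((\<lambda>s. right_translate s (orbit x \<psi>) - right_translate s0 (orbit x \<psi>)) \<longlongrightarrow> 0) (at s0)"
      by (rule tendsto_0_le)
    then show "((\<lambda>s. right_translate s (orbit x \<psi>)) \<longlongrightarrow> right_translate s0 (orbit x \<psi>)) (at s0 within UNIV)"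
      by (simp add: LIM_zero_iff)
  qed
  have "continuous_on UNIV (\<lambda>s. right_translate (s * t) (orbit x \<psi>))" for t
    using cont[OF functional_R[OF \<psi>], of "T t x" t] right_translate_C_r(2)[OF orbit_C_r[OF \<psi>, of x]]
    by (simp add: right_translate_orbit[OF \<psi>, of t, symmetric])
  then show ?thesis
    using cont[OF \<psi>, of x] orbit_C_r[OF \<psi>] right_translate_C_r(1)[OF orbit_C_r[OF \<psi>]]
    by (auto simp: C_norm_def continuous_map_in_subtopology)
qed

text \<open>
  The point \<open>R s0 v\<close> in the preceding estimate runs through a noncompact set as \<open>t\<close> varies, so strong
  continuity gives nothing uniform in \<open>t\<close>. Instead let \<open>\<Lambda>\<close> be a bounded functional on \<open>C_r\<close>
  and \<open>Q\<close> the average of the conjugates under \<open>\<Lambda>\<close>. Weak* continuity of \<open>T s\<close> on the ball allows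
  \<open>\<Lambda>\<close> to be moved past \<open>R s\<close>, so that \<open>\<Lambda>\<close> of the translate by \<open>s\<close> is
  \<open>\<psi> (R s (Q (T s x)))\<close>. This involves only the vector \<open>x\<close>, and strong continuity suffices.
\<close>

lemma orbit_C_weak:
  assumes \<psi>: "bw_continuous \<psi>"
  shows "orbit x \<psi> \<in> C_weak"
proof -
  have cont: "continuous_on UNIV (\<lambda>s. \<Lambda> (right_translate s (orbit x \<psi>)))"
      "continuous_on UNIV (\<lambda>s. \<Lambda> (right_translate (s * t) (orbit x \<psi>)))"
    if lin: "linear_on scaleR scaleR C_r \<Lambda>" and bdd: "bounded_on C_r \<Lambda>"
    for \<Lambda> :: "('s \<Rightarrow>\<^sub>C real) \<Rightarrow> real" and t
  proof -
    obtain C where C: "0 \<le> C" "\<And>f. f \<in> C_r \<Longrightarrow> \<bar>\<Lambda> f\<bar> \<le> C * norm f"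
      using bounded_onE[OF bdd] by auto
    obtain Q where Q: "Q \<in> operators scaleX" "range (blinfun_apply Q) \<subseteq> Y" 
        "\<And>x \<psi>. bw_continuous \<psi> \<Longrightarrow> \<psi> (Q x) = \<Lambda> (orbit x \<psi>)"
      using mean_operator[OF lin C(2,1) orbit_C_r[OF bw_functional]] by metis
    then have Q_mem: "Q x \<in> Y" for x by auto
    have key: "\<Lambda> (orbit x (\<lambda>y. \<psi> (R s y))) = \<psi> (R s (Q x))" for s x
    proof -
      obtain D where D: "0 \<le> D" "\<And>y. y \<in> Y \<Longrightarrow> norm (R s y) \<le> D * norm y"
        using bounded_onE[OF R_bounded] by blast
      define L where "L = (\<lambda>\<theta>. \<Lambda> (orbit x (\<lambda>y. \<theta> (R s y))))"
      have fR: "functional (\<lambda>y. \<theta> (R s y))" if "bw_continuous \<theta>" for \<theta>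
        using that by (intro functional_R bw_functional)
      obtain v where v: "v \<in> Y" "\<And>\<theta>. bw_continuous \<theta> \<Longrightarrow> L \<theta> = \<theta> v"
      proof (rule bw_dual_evaluation[of L "C * (M * norm P * norm x) * D"])
        show "L (\<lambda>y. \<theta> y + \<theta>' y) = L \<theta> + L \<theta>'" if "bw_continuous \<theta>" "bw_continuous \<theta>'" for \<theta> \<theta>'
          using lin fR[OF that(1)] fR[OF that(2)] fR[OF bw_continuous_add[OF that]]
          by (simp add: L_def orbit_add orbit_C_r linear_on_def)
        show "L (\<lambda>y. r * \<theta> y) = r * L \<theta>" if "bw_continuous \<theta>" for \<theta> r
          using lin fR[OF that] fR[OF bw_continuous_scaleR[OF that]]
          by (simp add: L_def orbit_scaleR orbit_C_r linear_on_def)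
        show "L \<theta> = L \<theta>'" if "\<And>y. y \<in> Y \<Longrightarrow> \<theta> y = \<theta>' y" for \<theta> \<theta>'
          unfolding L_def using that by (intro arg_cong[of _ _ \<Lambda>] orbit_cong) (simp add: R_mem)
        show "\<bar>L \<theta>\<bar> \<le> C * (M * norm P * norm x) * D * B"
          if \<theta>: "bw_continuous \<theta>" "0 \<le> B" "\<And>y. y \<in> Y \<Longrightarrow> \<bar>\<theta> y\<bar> \<le> B * norm y" for \<theta> B
        proof -
          have "\<bar>\<theta> (R s y)\<bar> \<le> (B * D) * norm y" if y: "y \<in> Y" for y
            using order_trans[OF \<theta>(3)[OF R_mem[OF y]] mult_left_mono[OF D(2)[OF y] \<theta>(2)]]
            by (simp add: mult.assoc)
          then have "norm (orbit x (\<lambda>y. \<theta> (R s y))) \<le> M * norm P * norm x * (B * D)"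
            using that D by (intro norm_orbit_le fR) auto
          then have "C * norm (orbit x (\<lambda>y. \<theta> (R s y))) \<le> C * (M * norm P * norm x * (B * D))"
            using C by (intro mult_left_mono)
          moreover have "\<bar>L \<theta>\<bar> \<le> C * norm (orbit x (\<lambda>y. \<theta> (R s y)))"
            unfolding L_def by (intro C orbit_C_r fR that)
          ultimately show ?thesis by (simp add: ac_simps)
        qed
      qed (use C D M_nonneg in auto)
      \<comment> \<open>Only \<open>T s\<close>, not its inverse, is known to preserve the class of functionals, so
        \<open>v = R s (Q x)\<close> is verified after applying \<open>T s\<close>.\<close>
      have "T s v = Q x"
      proof (rule eq_if_bw_equal)
        fix \<theta> assume \<theta>: "bw_continuous \<theta>"
        have "\<theta> (T s v) = L (\<lambda>y. \<theta> (T s y))" using v(2)[OF bw_continuous_T[OF \<theta>]] by simp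
        also have "\<dots> = \<Lambda> (orbit x \<theta>)"
          unfolding L_def by (intro arg_cong[of _ _ \<Lambda>] orbit_cong) (simp add: T_R)
        finally show "\<theta> (T s v) = \<theta> (Q x)" by (simp add: Q(3) \<theta>)
      qed (use v Q_mem in \<open>auto simp: T_mem\<close>)
      then have "R s (Q x) = v" using v R_T by metis
      then show ?thesis using v(2)[OF \<psi>] by (simp add: L_def)
    qed
    have translate: "\<Lambda> (right_translate s (orbit x \<psi>)) = \<psi> (R s (Q (T s x)))" for s
      by (simp add: right_translate_orbit bw_functional \<psi> key)
    have RQT: "continuous_on UNIV (\<lambda>s. R s (Q (T s x)))" for x
      by (intro R_continuous Q_mem T_continuous
          bounded_linear.continuous_on[OF blinfun.bounded_linear_right])
    show "continuous_on UNIV (\<lambda>s. \<Lambda> (right_translate s (orbit x \<psi>)))"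
      unfolding translate by (intro functional_continuous bw_functional \<psi> R_mem Q_mem RQT)
    have "continuous_on UNIV (\<lambda>s. \<psi> (R t (R s (Q (T s (T t x))))))"
      by (intro functional_continuous[OF functional_R] bw_functional \<psi> R_mem Q_mem RQT)
    then show "continuous_on UNIV (\<lambda>s. \<Lambda> (right_translate (s * t) (orbit x \<psi>)))"
      by (simp add: translate T_hom R_hom Q_mem)
  qed
  have orb: "orbit x \<psi> \<in> C_r" by (intro orbit_C_r bw_functional \<psi>)
  have weak: "continuous_map euclidean (weak_topology C_r) g"
    if g: "\<And>s. g s \<in> C_r" and cont: "\<And>\<Lambda>. linear_on scaleR scaleR C_r \<Lambda> \<Longrightarrow> bounded_on C_r \<Lambda> \<Longrightarrow>
      continuous_on UNIV (\<lambda>s. \<Lambda> (g s) :: real)" for g :: "'s \<Rightarrow> ('s \<Rightarrow>\<^sub>C real)"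
    unfolding weak_topology_def
  proof (rule continuous_map_initial_topologyI[OF g])
    have "(\<lambda>_. 0) \<in> {\<psi> :: ('s \<Rightarrow>\<^sub>C real) \<Rightarrow> real. linear_on scaleR scaleR C_r \<psi> \<and> bounded_on C_r \<psi>}"
      by (auto simp: linear_on_def bounded_on_def intro!: exI[of _ 0])
    then show "{\<psi> :: ('s \<Rightarrow>\<^sub>C real) \<Rightarrow> real. linear_on scaleR scaleR C_r \<psi> \<and> bounded_on C_r \<psi>} \<noteq> {}"
      by blast
  qed (use cont in simp)
  show ?thesis
    unfolding C_weak_def using orb right_translate_C_r(1)[OF orb] cont by (auto intro!: weak)
qed

text \<open>
  On points of \<open>Y\<close> the orbit functions are constant, and a mean fixes constants, so averaging gives a
  projection again. It commutes with \<open>T t\<close> because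
  \<open>conjugate s (T t x) = T t (conjugate (s * t) x)\<close> and a right invariant mean does not see the
  translation of \<open>s\<close> to \<open>s * t\<close>.
\<close>

lemma averaged_projection:
  assumes \<phi>: "right_invariant_mean V \<phi>" and V: "\<And>x \<psi>. bw_continuous \<psi> \<Longrightarrow> orbit x \<psi> \<in> V"
  shows "\<exists>Q. is_projection scaleX Y Q \<and> commutes_with_all T Q \<and> norm Q \<le> M * norm P"
proof -
  have mean: "linear_on scaleR scaleR V \<phi>"
      "\<And>f. f \<in> V \<Longrightarrow> (INF t. apply_bcontfun f t) \<le> \<phi> f"
      "\<And>f. f \<in> V \<Longrightarrow> \<phi> f \<le> (SUP t. apply_bcontfun f t)"
      "\<And>f s. f \<in> V \<Longrightarrow> \<phi> (right_translate s f) = \<phi> f"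
    using \<phi> by (auto simp: right_invariant_mean_def is_mean_def)
  have bound: "\<bar>\<phi> f\<bar> \<le> 1 * norm f" if "f \<in> V" for f
  proof -
    have f: "- norm f \<le> apply_bcontfun f t" "apply_bcontfun f t \<le> norm f" for t
      using norm_bounded[of f t] by (auto simp: abs_le_iff)
    have "- norm f \<le> (INF t. apply_bcontfun f t)" "(SUP t. apply_bcontfun f t) \<le> norm f"
      using f by (auto intro: cINF_greatest cSUP_least)
    then show ?thesis using mean(2,3)[OF that] by auto
  qed
  obtain Q where Q: "Q \<in> operators scaleX" "range (blinfun_apply Q) \<subseteq> Y" "norm Q \<le> 1 * M * norm P"
      "\<And>x \<psi>. bw_continuous \<psi> \<Longrightarrow> \<psi> (Q x) = \<phi> (orbit x \<psi>)"
    using mean_operator[OF mean(1) bound zero_le_one V] by metis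
  have Q_mem: "Q x \<in> Y" for x using Q(2) by auto
  have "Q y = y" if y: "y \<in> Y" for y
  proof (rule eq_if_bw_equal[OF Q_mem y])
    fix \<psi> assume \<psi>: "bw_continuous \<psi>"
    have "apply_bcontfun (orbit y \<psi>) t = \<psi> y" for t
      by (simp add: orbit_apply bw_functional \<psi> conjugate_fix y)
    then show "\<psi> (Q y) = \<psi> y"
      using mean(2,3)[OF V[OF \<psi>, of y]] by (simp add: Q(4) \<psi>)
  qed
  then have "is_projection scaleX Y Q" using Q by (simp add: is_projection_def)
  moreover have "Q (T t x) = T t (Q x)" for t x
  proof (rule eq_if_bw_equal)
    fix \<psi> assume \<psi>: "bw_continuous \<psi>"
    have "\<psi> (Q (T t x)) = \<phi> (orbit (T t x) \<psi>)" by (rule Q(4)[OF \<psi>])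
    also have "orbit (T t x) \<psi> = orbit (T t x) (\<lambda>y. \<psi> (T t (R t y)))"
      by (rule orbit_cong) (simp add: T_R)
    also have "\<dots> = right_translate t (orbit x (\<lambda>y. \<psi> (T t y)))"
      by (rule right_translate_orbit[symmetric]) (intro bw_functional bw_continuous_T \<psi>)
    also have "\<phi> \<dots> = \<phi> (orbit x (\<lambda>y. \<psi> (T t y)))"
      by (intro mean V bw_continuous_T \<psi>)
    also have "\<dots> = \<psi> (T t (Q x))" by (rule Q(4)[OF bw_continuous_T[OF \<psi>], symmetric])
    finally show "\<psi> (Q (T t x)) = \<psi> (T t (Q x))" .
  qed (auto simp: Q_mem T_mem)
  then have "commutes_with_all T Q"
    by (auto simp: commutes_with_all_def intro!: blinfun_eqI)
  ultimately show ?thesis using Q(3) by auto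
qed

end


section \<open>Existence of a minimal projection\<close>

context dual_subspace_action
begin

text \<open>
  A minimising sequence of commuting projections has a limit in the pointwise weak* sense along some
  filter. The limit fixes \<open>Y\<close>, it commutes with every \<open>T t\<close> since these are weak* continuous on
  bounded sets, and the norm is lower semicontinuous under such limits.
\<close>

lemma minimal_projection_exists:
  assumes "is_projection scaleX Y P0" "commutes_with_all T P0"
  shows "\<exists>P. minimal_projection scaleX Y T P"
proof -
  define S where "S = {P. is_projection scaleX Y P \<and> commutes_with_all T P}"
  define \<rho> where "\<rho> = (INF P\<in>S. norm P)"
  have "P0 \<in> S" using assms by (simp add: S_def)
  have bdd: "bdd_below (norm ` S)" by (auto simp: bdd_below_def intro: exI[of _ 0])
  have \<rho>_le: "\<rho> \<le> norm P" if "P \<in> S" for P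
    unfolding \<rho>_def using bdd that by (rule cINF_lower)
  have "0 \<le> \<rho>" unfolding \<rho>_def using \<open>P0 \<in> S\<close> by (intro cINF_greatest) auto
  have "\<exists>P\<in>S. norm P < \<rho> + 1 / real (Suc n)" for n
  proof -
    have "\<rho> < \<rho> + 1 / real (Suc n)" by simp
    then show ?thesis
      unfolding \<rho>_def using cINF_less_iff[OF _ bdd] \<open>P0 \<in> S\<close> by blast
  qed
  then obtain P where P: "\<And>n. P n \<in> S" "\<And>n. norm (P n) < \<rho> + 1 / real (Suc n)" by metis
  have proj: "is_projection scaleX Y (P n)" and comm: "P n o\<^sub>L T t = T t o\<^sub>L P n" for n t
    using P(1)[of n] by (simp_all add: S_def commutes_with_all_def)
  have P_mem: "P n x \<in> Y" and P_fix: "y \<in> Y \<Longrightarrow> P n y = y"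
    and P_scale: "P n (scaleX a x) = scaleX a (P n x)" for n x y a
    using proj[of n] by (auto simp: is_projection_def operators_def linear_on_def)
  have P_T: "P n (T t x) = T t (P n x)" for n t x
    using comm[of n t] by (metis blinfun_apply_blinfun_compose)
  have P_le: "norm (P n x) \<le> (\<rho> + 1 / real (Suc n)) * norm x" for n x
    using norm_blinfun[of "P n" x] mult_right_mono[OF less_imp_le[OF P(2)[of n]], of "norm x"] by simp
  have P_bound: "\<bar>\<psi> (P n x)\<bar> \<le> (\<rho> + 1 / real (Suc n)) * norm x * B"
    if "0 \<le> B" "\<And>y. y \<in> Y \<Longrightarrow> \<bar>\<psi> y\<bar> \<le> B * norm y" for \<psi> B n x
    using that(2)[OF P_mem, of n x] mult_right_mono[OF P_le \<open>0 \<le> B\<close>, of n x] by (simp add: mult.commute)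
  have "\<exists>B. 0 \<le> B \<and> (bw_continuous \<psi> \<longrightarrow> (\<forall>y\<in>Y. \<bar>\<psi> y\<bar> \<le> B * norm y))" for \<psi>
  proof (cases "bw_continuous \<psi>")
    case True
    obtain B where "0 \<le> B" "\<And>y. y \<in> Y \<Longrightarrow> \<bar>\<psi> y\<bar> \<le> B * norm y"
      using bounded_onE[OF bw_continuous_bounded[OF True]] by auto
    then show ?thesis by auto
  qed auto
  then have "\<exists>B. \<forall>\<psi>. 0 \<le> B \<psi> \<and> (bw_continuous \<psi> \<longrightarrow> (\<forall>y\<in>Y. \<bar>\<psi> y\<bar> \<le> B \<psi> * norm y))"
    by (intro choice allI)
  then obtain B where B: "\<And>\<psi>. 0 \<le> B \<psi>" "\<And>\<psi> y. bw_continuous \<psi> \<Longrightarrow> y \<in> Y \<Longrightarrow> \<bar>\<psi> y\<bar> \<le> B \<psi> * norm y"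
    by blast
  define a where "a = (\<lambda>n (x, \<psi>). if bw_continuous \<psi> then \<psi> (P n x) else 0)"
  have a_bound: "\<bar>a n i\<bar> \<le> (\<rho> + 1) * norm (fst i) * B (snd i)" for n i
  proof -
    obtain x \<psi> where i: "i = (x, \<psi>)" by (cases i)
    have "\<bar>\<psi> (P n x)\<bar> \<le> (\<rho> + 1) * norm x * B \<psi>" if \<psi>: "bw_continuous \<psi>"
    proof -
      have "\<bar>\<psi> (P n x)\<bar> \<le> (\<rho> + 1 / real (Suc n)) * norm x * B \<psi>"
        by (rule P_bound[OF B(1) B(2)[OF \<psi>]])
      also have "\<dots> \<le> (\<rho> + 1) * norm x * B \<psi>"
        by (intro mult_right_mono add_left_mono B(1) norm_ge_zero) simp
      finally show ?thesis .
    qed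
    moreover have "0 \<le> (\<rho> + 1) * norm x * B \<psi>"
      using \<open>0 \<le> \<rho>\<close> by (intro mult_nonneg_nonneg B(1)) auto
    ultimately show ?thesis by (simp add: i a_def)
  qed
  obtain G l where G: "G \<noteq> bot" "G \<le> sequentially" "\<And>i. ((\<lambda>n. a n i) \<longlongrightarrow> l i) G"
    by (rule simultaneous_limit_filter[of a "\<lambda>i. (\<rho> + 1) * norm (fst i) * B (snd i)", OF a_bound])
      (rule that)
  define L where "L = (\<lambda>x \<psi>. l (x, \<psi>))"
  have lim: "((\<lambda>n. \<psi> (P n x)) \<longlongrightarrow> L x \<psi>) G" if "bw_continuous \<psi>" for x \<psi>
    using G(3)[of "(x, \<psi>)"] that by (simp add: a_def L_def)
  have L_eq: "L x \<psi> = c" if "bw_continuous \<psi>" "((\<lambda>n. \<psi> (P n x)) \<longlongrightarrow> c) G" for x \<psi> c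
    using tendsto_unique[OF G(1) lim[OF that(1)] that(2)] .
  have lin: "\<psi> (u + v) = \<psi> u + \<psi> v" if "bw_continuous \<psi>" "u \<in> Y" "v \<in> Y" for \<psi> u v
    using bw_continuous_linear[OF that(1)] that by (simp add: linear_on_def)
  obtain Q where Q: "Q \<in> operators scaleX" "range (blinfun_apply Q) \<subseteq> Y" "norm Q \<le> \<rho>"
      "\<And>x \<psi>. bw_continuous \<psi> \<Longrightarrow> \<psi> (Q x) = L x \<psi>"
  proof (rule bw_operator[of L \<rho>])
    show "L x (\<lambda>y. \<psi> y + \<theta> y) = L x \<psi> + L x \<theta>" if "bw_continuous \<psi>" "bw_continuous \<theta>" for x \<psi> \<theta>
      using that by (intro L_eq bw_continuous_add tendsto_add lim)
    show "L x (\<lambda>y. r * \<psi> y) = r * L x \<psi>" if "bw_continuous \<psi>" for x \<psi> r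
      using that by (intro L_eq bw_continuous_scaleR tendsto_mult tendsto_const lim)
    show "L x \<psi> = L x \<theta>"
      if "bw_continuous \<psi>" "bw_continuous \<theta>" "\<And>y. y \<in> Y \<Longrightarrow> \<psi> y = \<theta> y" for x \<psi> \<theta>
      using lim[OF that(2), of x] that by (intro L_eq) (simp_all add: P_mem)
    show "L (x + x') \<psi> = L x \<psi> + L x' \<psi>" if "bw_continuous \<psi>" for x x' \<psi>
      using tendsto_add[OF lim[OF that, of x] lim[OF that, of x']] that
      by (intro L_eq) (simp_all add: blinfun.add_right lin P_mem)
    show "L (scaleX a x) \<psi> = L x (\<lambda>y. \<psi> (scaleX a y))" if "bw_continuous \<psi>" for x a \<psi>
      using lim[OF bw_continuous_scale[OF that], of a x] that by (intro L_eq) (simp_all add: P_scale)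
    show "\<bar>L x \<psi>\<bar> \<le> \<rho> * norm x * B"
      if "bw_continuous \<psi>" "0 \<le> B" "\<And>y. y \<in> Y \<Longrightarrow> \<bar>\<psi> y\<bar> \<le> B * norm y" for x \<psi> B
    proof (rule tendsto_le[OF G(1)])
      show "((\<lambda>n. \<bar>\<psi> (P n x)\<bar>) \<longlongrightarrow> \<bar>L x \<psi>\<bar>) G" by (intro tendsto_rabs lim that)
      have "(\<lambda>n. (\<rho> + 1 / real (Suc n)) * norm x * B) \<longlonglongrightarrow> (\<rho> + 0) * norm x * B"
        by (intro tendsto_intros LIMSEQ_Suc lim_1_over_n)
      then show "((\<lambda>n. (\<rho> + 1 / real (Suc n)) * norm x * B) \<longlongrightarrow> \<rho> * norm x * B) G"
        using tendsto_mono[OF G(2)] by simp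
      show "eventually (\<lambda>n. \<bar>\<psi> (P n x)\<bar> \<le> (\<rho> + 1 / real (Suc n)) * norm x * B) G"
        using P_bound[OF that(2,3)] by (intro always_eventually) auto
    qed
  qed (use \<open>0 \<le> \<rho>\<close> in auto)
  have Q_mem: "Q x \<in> Y" for x using Q(2) by auto
  have "Q y = y" if y: "y \<in> Y" for y
    using y by (intro eq_if_bw_equal Q_mem) (simp_all add: Q(4) L_eq P_fix)
  moreover have "Q (T t x) = T t (Q x)" for t x
  proof (rule eq_if_bw_equal)
    fix \<psi> assume \<psi>: "bw_continuous \<psi>"
    have "L (T t x) \<psi> = L x (\<lambda>y. \<psi> (T t y))"
      using lim[OF bw_continuous_T[OF \<psi>], of t x] by (intro L_eq \<psi>) (simp add: P_T)
    then show "\<psi> (Q (T t x)) = \<psi> (T t (Q x))"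
      using Q(4)[OF bw_continuous_T[OF \<psi>], of t x] by (simp add: Q(4) \<psi>)
  qed (auto simp: Q_mem T_mem)
  ultimately have "Q \<in> S"
    using Q by (auto simp: S_def is_projection_def commutes_with_all_def intro!: blinfun_eqI)
  then show ?thesis
    using Q(3) \<rho>_le unfolding minimal_projection_def S_def by (auto intro: order_trans)
qed

end

theorem theorem4p6:
  fixes scaleX :: "'k::{real_normed_field,euclidean_space} \<Rightarrow> 'x::banach \<Rightarrow> 'x"
    and scaleZ :: "'k \<Rightarrow> 'z::banach \<Rightarrow> 'z"
    and T :: "'s::{semigroup_mult,topological_space} \<Rightarrow> ('x \<Rightarrow>\<^sub>L 'x)"
    and Y :: "'x set"
    and J :: "'x \<Rightarrow> ('z \<Rightarrow>\<^sub>L 'k)"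
  assumes X: "banach_space_over scaleX"
    and T_operators: "\<And>s. T s \<in> operators scaleX"
    and T_hom: "\<And>s t. T (s * t) = T s o\<^sub>L T t"
    and Y_subspace: "module.subspace scaleX Y"
    and Y_closed: "closed Y"
    and p0: "(strongly_right_amenable TYPE('s) \<and>
               continuous_map euclidean strong_operator_topology T) \<or>
             (weakly_right_amenable TYPE('s) \<and> continuous_on UNIV T)"
    and p1: "\<And>s. blinfun_apply (T s) ` Y = Y \<and> isomorphism_on scaleX Y (blinfun_apply (T s))"
    and p2: "banach_space_over scaleZ" "dual_isometry scaleX Y scaleZ J"
    and p3: "\<And>s. continuous_map
               (subtopology (weak_star_topology Y J) {y\<in>Y. norm y \<le> 1})
               (weak_star_topology Y J) (blinfun_apply (T s))"
    and p4': "bdd_above (range (distortion Y T))"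
  shows "((\<exists>P0. minimal_projection scaleX Y T P0) \<longleftrightarrow> complemented scaleX Y) \<and>
         (complemented scaleX Y \<longrightarrow>
           (\<forall>P. minimal_projection scaleX Y T P \<longrightarrow> norm P \<le> m_const Y T * proj_const scaleX Y))"
proof -
  have "continuous_on UNIV (\<lambda>s. T s x)" for x
    using p0
  proof (elim disjE conjE)
    assume "continuous_map euclidean strong_operator_topology T"
    then show ?thesis by (simp add: continuous_on_strong_operator_topo_iff_coordinatewise)
  next
    assume "continuous_on UNIV T"
    then show ?thesis by (intro continuous_intros)
  qed
  then have "dual_subspace_action_axioms scaleX Y J T"
    using T_operators T_hom p1 p3 p4' by unfold_locales auto
  then interpret dual_subspace_action scaleX scaleZ Y J T
    using X p2 Y_subspace
    by (simp add: dual_subspace_action_def dual_subspace_def dual_subspace_axioms_def)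
  have average: "\<exists>Q. is_projection scaleX Y Q \<and> commutes_with_all T Q \<and> norm Q \<le> M * norm P"
    if "is_projection scaleX Y P" for P
  proof -
    interpret projection_action scaleX scaleZ Y J T P
      using that by unfold_locales
    show ?thesis
      using p0
    proof (elim disjE conjE)
      assume "strongly_right_amenable TYPE('s)"
      then show ?thesis
        using averaged_projection[OF _ orbit_C_weak] by (auto simp: strongly_right_amenable_def)
    next
      assume "weakly_right_amenable TYPE('s)" "continuous_on UNIV T"
      then show ?thesis
        using averaged_projection[OF _ orbit_C_norm[OF _ bw_functional]]
        by (auto simp: weakly_right_amenable_def)
    qed
  qed
  have "norm P0 \<le> M * proj_const scaleX Y"
    if P0: "minimal_projection scaleX Y T P0" for P0
  proof -
    have le: "norm P0 \<le> M * norm P" if "is_projection scaleX Y P" for P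
      using average[OF that] P0 by (auto simp: minimal_projection_def intro: order_trans)
    have ne: "{P. is_projection scaleX Y P} \<noteq> {}"
      using P0 by (auto simp: minimal_projection_def)
    show ?thesis
    \<comment> \<open>The infimum can be scaled only by a positive factor; \<open>M = 0\<close> forces \<open>P0 = 0\<close>.\<close>
    proof (cases "M = 0")
      case True
      then show ?thesis using le ne by auto
    next
      case False
      then have pos: "0 < M" using M_nonneg by simp
      have "norm P0 / M \<le> proj_const scaleX Y"
        unfolding proj_const_def using ne le pos
        by (intro cINF_greatest) (auto simp: pos_divide_le_eq mult.commute)
      then show ?thesis using pos by (simp add: pos_divide_le_eq mult.commute)
    qed
  qed
  moreover have "(\<exists>P0. minimal_projection scaleX Y T P0) \<longleftrightarrow> complemented scaleX Y"
    using average minimal_projection_exists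
    by (auto simp: complemented_def) (auto simp: minimal_projection_def)
  ultimately show ?thesis by blast
qed

end
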